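(* Let the matrices $A_{II}^{(i)},A_{I\Gamma}^{(i)},A_{\Gamma I}^{(i)},A_{\Gamma\Gamma}^{(i)}$, $I_{\Gamma\Gamma}^{(i)}$ ($i\in\{1,\dots,p\}$), $M_{\Gamma\Gamma}$, and the block matrix $A$ be as described in the context. Assume that there are entry-wise non-negative matrices $W_{\Gamma\Gamma}^{(i)}\ge 0$, $i\in\{1,\dots,p\}$, such that $$A_{\Gamma\Gamma}^{(i)}=W_{\Gamma\Gamma}^{(i)}\circ A_{\Gamma\Gamma},\qquad I_{\Gamma\Gamma}^{(i)}=W_{\Gamma\Gamma}^{(i)}\circ I_{\Gamma\Gamma}\qquad\text{for all } i,$$ where $\circ$ denotes the entry-wise product. If $A$ is an $\mathsf H$-matrix, $M_{\Gamma\Gamma}$ is diagonal, and $$\langle M_{\Gamma\Gamma}\rangle-|M_{\Gamma\Gamma}-A_{\Gamma\Gamma}|=\langle A_{\Gamma\Gamma}\rangle,$$ then the asynchronous primal Schur method is convergent.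
   Context: Matrices and vectors have entries in $\mathbb{K}=\mathbb{R}$ or $\mathbb{C}$. $\rho(\cdot)$ is the spectral radius, $|\mathcal A|$ is the entry-wise absolute value of a matrix or vector $\mathcal A$, $I$ is the identity matrix, and inequalities between matrices are entry-wise. An $\mathsf M$-matrix is a square matrix $\mathcal A$ for which there is a real $\alpha$ with $\alpha I-\mathcal A\ge 0$ and $\alpha>\rho(\alpha I-\mathcal A)$. The comparison matrix $\langle\mathcal A\rangle$ of a square matrix $\mathcal A=(a_{i,j})$ has diagonal entries $|a_{i,i}|$ and off-diagonal entries $-|a_{i,j}|$ ($i\neq j$). An $\mathsf H$-matrix is a matrix $\mathcal A$ such that $\langle\mathcal A\rangle$ is an $\mathsf M$-matrix. Setting (primal Schur domain decomposition with $p$ subdomains and interface $\Gamma$). For each $i\in\{1,\dots,p\}$ one is given matrices $A_{II}^{(i)}$ (square, nonsingular), $A_{I\Gamma}^{(i)}$, $A_{\Gamma I}^{(i)}$, $A_{\Gamma\Gamma}^{(i)}$ and vectors $b_I^{(i)}$, $b_\Gamma^{(i)}$ of compatible sizes; the size of the $I$-blocks may depend on $i$, and the index $\Gamma$ refers to one common finite index set. (When subdomain $i$ touches only a part $\Gamma_l$ of $\Gamma$, these blocks are obtained from local blocks through a Boolean restriction matrix $R^{(i)}_{\Gamma_l\Gamma}$ from $\Gamma$ to $\Gamma_l$, e.g. $A_{\Gamma\Gamma}^{(i)}={R^{(i)}_{\Gamma_l\Gamma}}^{\mathsf T}A^{(i)}_{\Gamma_l\Gamma_l}R^{(i)}_{\Gamma_l\Gamma}$.)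 Define $$S_{\Gamma\Gamma}^{(i)}:=A_{\Gamma\Gamma}^{(i)}-A_{\Gamma I}^{(i)}{A_{II}^{(i)}}^{-1}A_{I\Gamma}^{(i)},\quad d_\Gamma^{(i)}:=b_\Gamma^{(i)}-A_{\Gamma I}^{(i)}{A_{II}^{(i)}}^{-1}b_I^{(i)},\quad S_{\Gamma\Gamma}:=\sum_{i=1}^pS_{\Gamma\Gamma}^{(i)},\quad d_\Gamma:=\sum_{i=1}^pd_\Gamma^{(i)}.$$ The interface problem is $S_{\Gamma\Gamma}x_\Gamma=d_\Gamma$. Let $I_{\Gamma\Gamma}$ be the identity matrix on $\Gamma$, let $M_{\Gamma\Gamma}$ be a nonsingular matrix on $\Gamma$, and let $I_{\Gamma\Gamma}^{(1)},\dots,I_{\Gamma\Gamma}^{(p)}$ be matrices on $\Gamma$ with $\sum_{i=1}^pI_{\Gamma\Gamma}^{(i)}=I_{\Gamma\Gamma}$. Block matrix: $$A:=\begin{bmatrix}A_{II}^{(1)}&&0&A_{I\Gamma}^{(1)}\\ &\ddots&&\vdots\\ 0&&A_{II}^{(p)}&A_{I\Gamma}^{(p)}\\ A_{\Gamma I}^{(1)}&\cdots&A_{\Gamma I}^{(p)}&A_{\Gamma\Gamma}\end{bmatrix},\qquad A_{\Gamma\Gamma}:=\sum_{i=1}^pA_{\Gamma\Gamma}^{(i)}.$$ Asynchronous primal Schur method. Given initial vectors $x_\Gamma^{(i),0}$ ($i\in\{1,\dots,p\}$), sets $P^{(k)}\subseteq\{1,\dots,p\}$ ($k\in\mathbb{N}$)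 and maps $\tau_j^i:\mathbb{N}\to\mathbb{N}$ ($i,j\in\{1,\dots,p\}$) with $\tau_j^i(k)\le k$, such that (a) for every $i$, the set $\{k\in\mathbb{N}: i\in P^{(k)}\}$ is infinite, and (b) for all $i,j$, $\lim_{k\to\infty}\tau_j^i(k)=+\infty$, the method generates, for $k\in\mathbb{N}$ and $i\in\{1,\dots,p\}$, $$y_\Gamma^{(i),k}:=I_{\Gamma\Gamma}^{(i)}x_\Gamma^{(i),k}+M_{\Gamma\Gamma}^{-1}\left(d_\Gamma^{(i)}-S_{\Gamma\Gamma}^{(i)}x_\Gamma^{(i),k}\right),\qquad x_\Gamma^{(i),k+1}=\begin{cases}\sum_{j=1}^py_\Gamma^{(j),\tau_j^i(k)},& i\in P^{(k)},\\ x_\Gamma^{(i),k},& i\notin P^{(k)}.\end{cases}$$ The method is called convergent if, for all choices of the initial vectors $x_\Gamma^{(i),0}$, of sets $P^{(k)}\subseteq\{1,\dots,p\}$ such that $\{k\in\mathbb{N}: i\in P^{(k)}\}$ is infinite for every $i$, and of maps $\tau_j^i:\mathbb{N}\to\mathbb{N}$ such that $\tau_j^i(k)\le k$ for all $k$ and $\lim_{k\to\infty}\tau_j^i(k)=+\infty$ for all $i,j$, each sequence $(x_\Gamma^{(i),k})_{k}$, $i\in\{1,\dots,p\}$, converges as $k\to\infty$ to the solution $x_\Gamma$ of $S_{\Gamma\Gamma}x_\Gamma=d_\Gamma$. *)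

theory Defs
  imports "Jordan_Normal_Form.Spectral_Radius" "Jordan_Normal_Form.Gauss_Jordan_Elimination"
begin

text \<open>
  The scalar field is a type of class \<open>real_normed_field\<close>. Since the norm of that class is
  multiplicative, the Gelfand--Mazur theorem shows that its instances are, up to isometric
  isomorphism, exactly the fields of real and of complex numbers. Subdomains and vector
  and matrix entries are numbered from 0.
\<close>

text \<open>Only meaningful for invertible square matrices.\<close>
definition mat_inv :: "'a::field mat \<Rightarrow> 'a mat" where
  "mat_inv A = the (mat_inverse A)"

definition abs_mat :: "'a::real_normed_field mat \<Rightarrow> real mat" where
  "abs_mat A = map_mat norm A"

definition comparison_mat :: "'a::real_normed_field mat \<Rightarrow> real mat" where
  "comparison_mat A = mat (dim_row A) (dim_col A)
     (\<lambda>(r, c). if r = c then norm (A $$ (r, c)) else - norm (A $$ (r, c)))"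

text \<open>The spectral radius is that of the library, i.e. the maximal modulus of a complex
  eigenvalue, hence the embedding of the real matrix into the complex ones.\<close>
definition M_matrix :: "real mat \<Rightarrow> bool" where
  "M_matrix A \<longleftrightarrow> square_mat A \<and>
     (\<exists>\<alpha>::real. let B = \<alpha> \<cdot>\<^sub>m 1\<^sub>m (dim_row A) - A in
        0\<^sub>m (dim_row A) (dim_row A) \<le> B \<and> \<alpha> > spectral_radius (map_mat complex_of_real B))"

definition H_matrix :: "'a::real_normed_field mat \<Rightarrow> bool" where
  "H_matrix A \<longleftrightarrow> square_mat A \<and> M_matrix (comparison_mat A)"

text \<open>Entry-wise product, with a real left factor.\<close>
definition hadamard :: "real mat \<Rightarrow> 'a::real_normed_field mat \<Rightarrow> 'a mat" where
  "hadamard W A = mat (dim_row A) (dim_col A) (\<lambda>rc. of_real (W $$ rc) * A $$ rc)"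

text \<open>The sum of the \<open>m \<times> m\<close> matrices \<open>F 0, \<dots>, F (p - 1)\<close>.\<close>
definition mat_sum :: "nat \<Rightarrow> nat \<Rightarrow> (nat \<Rightarrow> 'a::comm_monoid_add mat) \<Rightarrow> 'a mat" where
  "mat_sum m p F = mat m m (\<lambda>rc. \<Sum>i<p. F i $$ rc)"

text \<open>In the following, \<open>m\<close> is the number of interface unknowns and \<open>p\<close> the number of
  subdomains.\<close>

definition stack_rows :: "nat \<Rightarrow> 'a::zero mat list \<Rightarrow> 'a mat" where
  "stack_rows m Bs = foldr append_rows Bs (0\<^sub>m 0 m)"

definition stack_cols :: "nat \<Rightarrow> 'a::zero mat list \<Rightarrow> 'a mat" where
  "stack_cols m Bs = transpose_mat (stack_rows m (map transpose_mat Bs))"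

definition global_mat ::
  "nat \<Rightarrow> nat \<Rightarrow> (nat \<Rightarrow> 'a::comm_monoid_add mat) \<Rightarrow> (nat \<Rightarrow> 'a mat) \<Rightarrow>
   (nat \<Rightarrow> 'a mat) \<Rightarrow> (nat \<Rightarrow> 'a mat) \<Rightarrow> 'a mat" where
  "global_mat m p AII AIG AGI AGG = four_block_mat
     (diag_block_mat (map AII [0..<p])) (stack_rows m (map AIG [0..<p]))
     (stack_cols m (map AGI [0..<p]))   (mat_sum m p AGG)"

definition schur_mat ::
  "(nat \<Rightarrow> 'a::field mat) \<Rightarrow> (nat \<Rightarrow> 'a mat) \<Rightarrow> (nat \<Rightarrow> 'a mat) \<Rightarrow> (nat \<Rightarrow> 'a mat) \<Rightarrow>
   nat \<Rightarrow> 'a mat" where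
  "schur_mat AII AIG AGI AGG i = AGG i - AGI i * mat_inv (AII i) * AIG i"

definition schur_rhs ::
  "(nat \<Rightarrow> 'a::field mat) \<Rightarrow> (nat \<Rightarrow> 'a mat) \<Rightarrow> (nat \<Rightarrow> 'a vec) \<Rightarrow> (nat \<Rightarrow> 'a vec) \<Rightarrow>
   nat \<Rightarrow> 'a vec" where
  "schur_rhs AII AGI bI bG i = bG i - (AGI i * mat_inv (AII i)) *\<^sub>v bI i"

text \<open>\<open>x i k\<close> is the iterate of subdomain \<open>i\<close> at step \<open>k\<close>, and \<open>\<tau> i j k\<close> is the step at which
  the data of subdomain \<open>j\<close> used by subdomain \<open>i\<close> at step \<open>k\<close> were produced. \<open>S\<close>, \<open>d\<close> and \<open>J\<close> are
  the local Schur matrices, right-hand sides and splittings of the identity.\<close>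
definition async_schur_iterates ::
  "nat \<Rightarrow> nat \<Rightarrow> (nat \<Rightarrow> 'a::field mat) \<Rightarrow> (nat \<Rightarrow> 'a vec) \<Rightarrow> 'a mat \<Rightarrow> (nat \<Rightarrow> 'a mat) \<Rightarrow>
   (nat \<Rightarrow> nat set) \<Rightarrow> (nat \<Rightarrow> nat \<Rightarrow> nat \<Rightarrow> nat) \<Rightarrow> (nat \<Rightarrow> nat \<Rightarrow> 'a vec) \<Rightarrow> bool" where
  "async_schur_iterates m p S d M J P \<tau> x \<longleftrightarrow>
     (let y = (\<lambda>j k. J j *\<^sub>v x j k + mat_inv M *\<^sub>v (d j - S j *\<^sub>v x j k)) in
        \<forall>i<p. x i 0 \<in> carrier_vec m \<and>
          (\<forall>k. x i (Suc k) =
             (if i \<in> P k then finsum_vec TYPE('a) m (\<lambda>j. y j (\<tau> i j k)) {..<p} else x i k)))"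

text \<open>Well-posedness of the interface problem is part of convergence; the limit of the
  vectors is taken entry by entry.\<close>
definition async_schur_convergent ::
  "nat \<Rightarrow> nat \<Rightarrow> (nat \<Rightarrow> 'a::real_normed_field mat) \<Rightarrow> (nat \<Rightarrow> 'a vec) \<Rightarrow> 'a mat \<Rightarrow>
   (nat \<Rightarrow> 'a mat) \<Rightarrow> bool" where
  "async_schur_convergent m p S d M J \<longleftrightarrow>
     (let is_sol = (\<lambda>z. z \<in> carrier_vec m \<and> mat_sum m p S *\<^sub>v z = finsum_vec TYPE('a) m d {..<p}) in
      (\<exists>!z. is_sol z) \<and>
      (\<forall>z P \<tau> x.
         is_sol z \<longrightarrow>
         (\<forall>k. P k \<subseteq> {..<p}) \<longrightarrow>
         (\<forall>i<p. infinite {k. i \<in> P k}) \<longrightarrow>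
         (\<forall>i<p. \<forall>j<p. (\<forall>k. \<tau> i j k \<le> k) \<and> filterlim (\<tau> i j) at_top sequentially) \<longrightarrow>
         async_schur_iterates m p S d M J P \<tau> x \<longrightarrow>
         (\<forall>i<p. \<forall>r<m. (\<lambda>k. x i k $ r) \<longlonglongrightarrow> z $ r)))"

end

theory Submission
  imports Defs
begin

text \<open>
  Write \<open>N\<^sub>j x = J\<^sub>j x + M\<^bsup>-1\<^esup> (d\<^sub>j - S\<^sub>j x)\<close> for the contribution of subdomain \<open>j\<close>. A solution \<open>z\<close> of the
  interface problem satisfies \<open>\<Sum>\<^sub>j N\<^sub>j z = z\<close>, because the \<open>J\<^sub>j\<close> add up to the identity. Hence an
  update replaces the error of a subdomain by \<open>\<Sum>\<^sub>j (J\<^sub>j - M\<^bsup>-1\<^esup> S\<^sub>j) e\<^sub>j\<close>, where the \<open>e\<^sub>j\<close> are errors of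
  earlier steps. The \<open>e\<^sub>j\<close> come from different steps, so what is needed is a positive weight \<open>v\<close> on the
  interface and a factor \<open>k < 1\<close> such that \<open>\<bar>e\<^sub>j\<bar> \<le> t v\<close> for all \<open>j\<close> implies that the sum is at most
  \<open>k t v\<close> (lemma \<open>contraction\<close>). Such a bound gives convergence for all admissible delays
  (\<open>asynchronous_contraction\<close>): once all the data in use obey the bound \<open>t v\<close>, each subdomain obeys
  \<open>k t v\<close> from its next update on, and the steps whose data are read
  tend to infinity.

  The weights come from the \<open>H\<close>-matrix property: there is a positive vector \<open>(u\<^sub>1, \<dots>, u\<^sub>p, v)\<close> with respect
  to which the rows of the block matrix are strictly diagonally dominant
  (\<open>H_matrix_weighted_dominance\<close>). The interior rows show that \<open>\<bar>e\<bar> \<le> t v\<close> implies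
  \<open>\<bar>A\<^sub>I\<^sub>I\<^bsup>-1\<^esup> A\<^sub>I\<^sub>\<Gamma> e\<bar> \<le> t u\<^sub>j\<close> (\<open>dominant_solution_bound\<close>), so the Schur complement term costs at most
  \<open>t \<bar>M\<bar>\<^bsup>-1\<^esup> \<bar>A\<^sub>\<Gamma>\<^sub>I\<bar> u\<^sub>j\<close>. As \<open>M\<close> is diagonal, the remaining part of \<open>J\<^sub>j - M\<^bsup>-1\<^esup> S\<^sub>j\<close> is
  \<open>W\<^sub>j \<circ> (M\<^bsup>-1\<^esup> (M - A\<^sub>\<Gamma>\<^sub>\<Gamma>))\<close>, and the non-negative weights \<open>W\<^sub>j\<close> add up to 1 wherever \<open>M - A\<^sub>\<Gamma>\<^sub>\<Gamma>\<close> is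
  non-zero. Taking absolute values subdomain by subdomain therefore loses nothing: these parts together
  cost at most \<open>t \<bar>M\<bar>\<^bsup>-1\<^esup> \<bar>M - A\<^sub>\<Gamma>\<^sub>\<Gamma>\<bar> v = t \<bar>M\<bar>\<^bsup>-1\<^esup> (\<bar>M\<bar> - \<langle>A\<^sub>\<Gamma>\<^sub>\<Gamma>\<rangle>) v\<close>. Altogether the new error is at
  most \<open>t \<bar>M\<bar>\<^bsup>-1\<^esup> (\<bar>M\<bar> v - \<langle>A\<^sub>\<Gamma>\<^sub>\<Gamma>\<rangle> v + \<Sum>\<^sub>j \<bar>A\<^sub>\<Gamma>\<^sub>I\<bar> u\<^sub>j)\<close>, which is strictly below \<open>t v\<close> for \<open>t > 0\<close> by the
  dominance of the interface rows.

  The same estimate with \<open>e\<^sub>j = z\<close> for all \<open>j\<close> shows that \<open>S\<^sub>\<Gamma>\<^sub>\<Gamma> z = 0\<close> only for \<open>z = 0\<close>, so that the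
  interface problem has exactly one solution.
\<close>

section \<open>Positive vectors for M-matrices and H-matrices\<close>

lemma eigenvalue_smult_cancel:
  fixes A :: "complex mat"
  assumes A: "A \<in> carrier_mat n n" and ev: "eigenvalue (c \<cdot>\<^sub>m A) k" and c: "c \<noteq> 0"
  shows "eigenvalue A (k / c)"
proof -
  from ev A obtain v where v: "v \<in> carrier_vec n" "v \<noteq> 0\<^sub>v n" "(c \<cdot>\<^sub>m A) *\<^sub>v v = k \<cdot>\<^sub>v v"
    unfolding eigenvalue_def eigenvector_def by auto
  have "A *\<^sub>v v = (k / c) \<cdot>\<^sub>v v"
  proof (rule eq_vecI)
    fix i assume i: "i < dim_vec ((k / c) \<cdot>\<^sub>v v)"
    hence i': "i < n" using v by simp
    have "((c \<cdot>\<^sub>m A) *\<^sub>v v) $ i = (k \<cdot>\<^sub>v v) $ i" using v(3) by simp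
    hence "c * (A *\<^sub>v v) $ i = k * v $ i"
      using i' A v(1) by (simp add: scalar_prod_def sum_distrib_left mult.assoc)
    thus "(A *\<^sub>v v) $ i = ((k / c) \<cdot>\<^sub>v v) $ i"
      using c i' v(1) by (simp add: field_simps)
  qed (use A v in auto)
  thus ?thesis using v A unfolding eigenvalue_def eigenvector_def by auto
qed

lemma mult_pow_mat_commute:
  assumes A: "A \<in> carrier_mat n n"
  shows "A * A ^\<^sub>m k = A ^\<^sub>m k * A"
proof (induction k)
  case (Suc k)
  have P: "A ^\<^sub>m k \<in> carrier_mat n n" using A by (rule pow_carrier_mat)
  have "A * (A ^\<^sub>m k * A) = (A * A ^\<^sub>m k) * A" using assoc_mult_mat[OF A P A] by simp
  thus ?case using Suc by simp
qed (use A in auto)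

text \<open>
  After division by \<open>b\<close> the spectral radius is below 1, which bounds the powers of the matrix
  uniformly. The iterates are written as plain functions of the row index so that the sums in which
  they are used need no matrix arithmetic.
\<close>

lemma power_iterates_bounded:
  fixes B :: "real mat"
  assumes B: "B \<in> carrier_mat n n" and n: "n > 0" and b: "b > 0"
    and sr: "spectral_radius (map_mat complex_of_real B) < b"
  shows "\<exists>c. \<forall>k. \<forall>r<n. \<bar>((\<lambda>h r. \<Sum>s<n. B $$ (r, s) * h s) ^^ k) (\<lambda>_. 1) r\<bar> \<le> c * b ^ k"
proof -
  define BC where "BC = map_mat complex_of_real B"
  define C where "C = complex_of_real (1 / b) \<cdot>\<^sub>m BC"
  define T where "T = (\<lambda>h r. \<Sum>s<n. B $$ (r, s) * h s)"
  have BC: "BC \<in> carrier_mat n n" and C: "C \<in> carrier_mat n n"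
    using B by (auto simp: BC_def C_def)
  have "spectral_radius C < 1"
  proof -
    obtain k where k: "eigenvalue C k" "spectral_radius C = norm k"
      using spectral_radius_mem_max(1)[OF C n] unfolding spectrum_def by auto
    have "eigenvalue BC (k / complex_of_real (1 / b))"
      using eigenvalue_smult_cancel[OF BC, of "complex_of_real (1 / b)" k] k(1) b
      unfolding C_def by simp
    hence "norm (k / complex_of_real (1 / b)) \<le> spectral_radius BC"
      by (intro spectral_radius_mem_max(2)[OF BC n]) (auto simp: spectrum_def)
    moreover have "norm (k / complex_of_real (1 / b)) = norm k * b"
      using b by (simp add: norm_mult)
    ultimately have "norm k * b < b" using sr unfolding BC_def by linarith
    thus ?thesis using k b by (simp add: mult_less_cancel_right2)
  qed
  then obtain c where c: "\<And>k. norm_bound (C ^\<^sub>m k) c"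
    using spectral_radius_jnf_norm_bound_less_1_upper_triangular[OF C] by blast
  have entry: "complex_of_real ((T ^^ k) (\<lambda>_. 1) r) = of_real (b ^ k) * (\<Sum>s<n. (C ^\<^sub>m k) $$ (r, s))"
    if "r < n" for k r using that
  proof (induction k arbitrary: r)
    case 0
    thus ?case using C by (simp add: sum.delta[of "{..<n}" r "\<lambda>_. 1", symmetric])
  next
    case (Suc k)
    have P: "C ^\<^sub>m k \<in> carrier_mat n n" using C by (rule pow_carrier_mat)
    have "(C ^\<^sub>m Suc k) $$ (r, s) = (\<Sum>t<n. C $$ (r, t) * (C ^\<^sub>m k) $$ (t, s))" if "s < n" for s
      using mult_pow_mat_commute[OF C, of k, symmetric] that Suc.prems C P
      by (simp add: scalar_prod_def atLeast0LessThan)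
    hence "(\<Sum>s<n. (C ^\<^sub>m Suc k) $$ (r, s)) = (\<Sum>s<n. \<Sum>t<n. C $$ (r, t) * (C ^\<^sub>m k) $$ (t, s))"
      by (intro sum.cong) auto
    also have "\<dots> = (\<Sum>t<n. C $$ (r, t) * (\<Sum>s<n. (C ^\<^sub>m k) $$ (t, s)))"
      by (subst sum.swap) (simp add: sum_distrib_left)
    finally have 1: "of_real b * (\<Sum>s<n. (C ^\<^sub>m Suc k) $$ (r, s)) =
        (\<Sum>t<n. of_real (B $$ (r, t)) * (\<Sum>s<n. (C ^\<^sub>m k) $$ (t, s)))"
      using b B Suc.prems by (simp add: C_def BC_def sum_distrib_left)
    have "complex_of_real ((T ^^ Suc k) (\<lambda>_. 1) r) =
        (\<Sum>t<n. of_real (B $$ (r, t)) * complex_of_real ((T ^^ k) (\<lambda>_. 1) t))"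
      by (simp add: T_def)
    also have "\<dots> = (\<Sum>t<n. of_real (B $$ (r, t)) * (of_real (b ^ k) * (\<Sum>s<n. (C ^\<^sub>m k) $$ (t, s))))"
      by (intro sum.cong refl) (use Suc.IH in auto)
    also have "\<dots> = of_real (b ^ k) * (\<Sum>t<n. of_real (B $$ (r, t)) * (\<Sum>s<n. (C ^\<^sub>m k) $$ (t, s)))"
      by (simp add: sum_distrib_left mult_ac)
    finally show ?case unfolding 1[symmetric] by (simp add: mult_ac)
  qed
  have "\<bar>(T ^^ k) (\<lambda>_. 1) r\<bar> \<le> (real n * c) * b ^ k" if r: "r < n" for k r
  proof -
    have "\<bar>(T ^^ k) (\<lambda>_. 1) r\<bar> = norm (complex_of_real ((T ^^ k) (\<lambda>_. 1) r))" by simp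
    also have "\<dots> = b ^ k * norm (\<Sum>s<n. (C ^\<^sub>m k) $$ (r, s))"
      unfolding entry[OF r] norm_mult using b by (simp add: norm_power)
    also have "\<dots> \<le> b ^ k * (real n * c)"
    proof (intro mult_left_mono)
      have "norm (\<Sum>s<n. (C ^\<^sub>m k) $$ (r, s)) \<le> (\<Sum>s<n. c)"
        using c[of k] r C by (intro sum_norm_le) (auto simp: norm_bound_def)
      thus "norm (\<Sum>s<n. (C ^\<^sub>m k) $$ (r, s)) \<le> real n * c" by simp
    qed (use b in auto)
    finally show ?thesis by (simp add: mult_ac)
  qed
  thus ?thesis unfolding T_def by blast
qed

text \<open>
  With \<open>A = a I - B\<close> one would like to take \<open>u = a A\<^bsup>-1\<^esup> 1\<close>, the Neumann series
  \<open>\<Sum>\<^sub>k (B / a)\<^sup>k 1\<close>. A partial sum with \<open>K\<close> terms already suffices: \<open>A\<close> maps it to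
  \<open>a (1 - (B / a)\<^sup>K 1)\<close>, which is positive as soon as all entries of \<open>(B / a)\<^sup>K 1\<close> are below 1.
\<close>

lemma M_matrix_positive_vector:
  assumes M: "M_matrix A" and A: "A \<in> carrier_mat n n"
  shows "\<exists>u. (\<forall>r<n. u r > 0) \<and> (\<forall>r<n. (\<Sum>s<n. A $$ (r, s) * u s) > 0)"
proof (cases "n = 0")
  case False
  hence n: "n > 0" by simp
  from M A obtain a where
    nonneg: "0\<^sub>m n n \<le> a \<cdot>\<^sub>m 1\<^sub>m n - A" and
    sr: "spectral_radius (map_mat complex_of_real (a \<cdot>\<^sub>m 1\<^sub>m n - A)) < a"
    unfolding M_matrix_def Let_def by auto
  define B where "B = a \<cdot>\<^sub>m 1\<^sub>m n - A"
  define rho where "rho = spectral_radius (map_mat complex_of_real B)"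
  \<comment> \<open>Any number strictly between the spectral radius and \<open>a\<close>: powers of \<open>B\<close> grow at most like \<open>b\<^sup>k\<close>,
    hence \<open>(B / a)\<^sup>k\<close> tends to 0.\<close>
  define b where "b = (rho + a) / 2"
  have B: "B \<in> carrier_mat n n" using A by (auto simp: B_def)
  hence BC: "map_mat complex_of_real B \<in> carrier_mat n n" by simp
  have rho0: "rho \<ge> 0" using spectral_radius_mem_max(1)[OF BC n] by (auto simp: rho_def)
  have rhoa: "rho < a" using sr by (simp add: rho_def B_def)
  have b: "b > 0" "rho < b" "b < a" using rho0 rhoa by (auto simp: b_def)
  have B0: "B $$ (r, s) \<ge> 0" if "r < n" "s < n" for r s
    using nonneg that A unfolding B_def[symmetric] less_eq_mat_def using B by auto
  define T where "T = (\<lambda>h r. \<Sum>s<n. B $$ (r, s) * h s)"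
  obtain c where c: "\<And>k r. r < n \<Longrightarrow> \<bar>(T ^^ k) (\<lambda>_. 1) r\<bar> \<le> c * b ^ k"
    using power_iterates_bounded[OF B n b(1)] b(2) unfolding rho_def T_def by blast
  define q where "q = (\<lambda>k r. (T ^^ k) (\<lambda>_. 1) r / a ^ k)"
  have a: "a > 0" using b by simp
  have q_Suc: "(\<Sum>s<n. B $$ (r, s) * q k s) = a * q (Suc k) r" for k r
    using a by (simp add: q_def T_def sum_divide_distrib sum_distrib_left)
  have q_nonneg: "q k r \<ge> 0" if "r < n" for k r
  proof -
    have "(T ^^ k) (\<lambda>_. 1) r \<ge> 0" using that
      by (induction k arbitrary: r) (auto simp: T_def intro!: sum_nonneg mult_nonneg_nonneg B0)
    thus ?thesis using a by (simp add: q_def)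
  qed
  have "(\<lambda>k. c * (b / a) ^ k) \<longlonglongrightarrow> c * 0"
    using b a by (intro tendsto_mult_left LIMSEQ_realpow_zero) auto
  hence "\<forall>\<^sub>F k in sequentially. c * (b / a) ^ k < 1" by (intro order_tendstoD) auto
  then obtain K where K: "c * (b / a) ^ K < 1" by (auto simp: eventually_sequentially)
  have qK: "q K r < 1" if "r < n" for r
  proof -
    have "q K r \<le> c * b ^ K / a ^ K"
      using c[OF that, of K] a unfolding q_def by (intro divide_right_mono) auto
    thus ?thesis using K by (simp add: power_divide)
  qed
  have K0: "K > 0"
  proof (rule ccontr)
    assume "\<not> K > 0"
    hence "q K 0 = 1" by (simp add: q_def)
    thus False using qK[OF n] by simp
  qed
  define u where "u = (\<lambda>r. \<Sum>k<K. q k r)"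
  have "u r > 0" if "r < n" for r
  proof -
    have "q 0 r \<le> u r" unfolding u_def
      by (rule member_le_sum) (use K0 q_nonneg[OF that] in auto)
    thus ?thesis by (simp add: q_def)
  qed
  moreover have "(\<Sum>s<n. A $$ (r, s) * u s) > 0" if r: "r < n" for r
  proof -
    have "(\<Sum>s<n. A $$ (r, s) * u s) = (\<Sum>s<n. (if s = r then a * u r else 0) - B $$ (r, s) * u s)"
      by (rule sum.cong) (use r A in \<open>auto simp: B_def algebra_simps\<close>)
    also have "\<dots> = a * u r - (\<Sum>s<n. B $$ (r, s) * u s)"
      using r by (simp add: sum_subtractf)
    also have "(\<Sum>s<n. B $$ (r, s) * u s) = (\<Sum>k<K. \<Sum>s<n. B $$ (r, s) * q k s)"
      unfolding u_def sum_distrib_left by (rule sum.swap)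
    also have "\<dots> = a * (\<Sum>k<K. q (Suc k) r)" by (simp add: q_Suc sum_distrib_left)
    also have "a * u r - \<dots> = a * (\<Sum>k<K. q k r - q (Suc k) r)"
      by (simp add: u_def sum_subtractf algebra_simps)
    also have "(\<Sum>k<K. q k r - q (Suc k) r) = 1 - q K r"
      using sum_lessThan_telescope'[of "\<lambda>k. q k r" K] by (simp add: q_def)
    finally show ?thesis using a qK[OF r] by simp
  qed
  ultimately show ?thesis by blast
qed simp

text \<open>
  This is the form in which the \<open>H\<close>-matrix property enters the estimates: strict diagonal dominance
  after scaling the columns by a positive vector.
\<close>

lemma H_matrix_weighted_dominance:
  assumes H: "H_matrix A" and A: "A \<in> carrier_mat n n"
  shows "\<exists>u. (\<forall>r<n. u r > 0) \<and>
    (\<forall>r<n. (\<Sum>s\<in>{..<n} - {r}. norm (A $$ (r, s)) * u s) < norm (A $$ (r, r)) * u r)"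
proof -
  have CA: "comparison_mat A \<in> carrier_mat n n" using A by (auto simp: comparison_mat_def)
  have entry: "(\<Sum>s<n. comparison_mat A $$ (r, s) * u s) =
      norm (A $$ (r, r)) * u r - (\<Sum>s\<in>{..<n} - {r}. norm (A $$ (r, s)) * u s)" if "r < n" for r u
  proof -
    have "(\<Sum>s<n. comparison_mat A $$ (r, s) * u s) =
        norm (A $$ (r, r)) * u r + (\<Sum>s\<in>{..<n} - {r}. comparison_mat A $$ (r, s) * u s)"
      using that A by (subst sum.remove[of _ r]) (auto simp: comparison_mat_def)
    also have "(\<Sum>s\<in>{..<n} - {r}. comparison_mat A $$ (r, s) * u s) =
        (\<Sum>s\<in>{..<n} - {r}. - (norm (A $$ (r, s)) * u s))"
      by (rule sum.cong) (use that A in \<open>auto simp: comparison_mat_def\<close>)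
    finally show ?thesis by (simp add: sum_negf)
  qed
  obtain u where u: "\<forall>r<n. u r > 0" "\<forall>r<n. (\<Sum>s<n. comparison_mat A $$ (r, s) * u s) > 0"
    using M_matrix_positive_vector[OF _ CA] H unfolding H_matrix_def by blast
  hence "\<forall>r<n. (\<Sum>s\<in>{..<n} - {r}. norm (A $$ (r, s)) * u s) < norm (A $$ (r, r)) * u r"
    by (simp add: entry)
  with u(1) show ?thesis by blast
qed

section \<open>Entries of block matrices\<close>

text \<open>
  If the blocks have sizes \<open>n 0, n 1, \<dots>\<close>, then entry \<open>r\<close> of block \<open>i\<close> has the global index
  \<open>sum n {..<i} + r\<close>, and the interface unknowns start at \<open>sum n {..<p}\<close>.
\<close>

lemma block_index_less:
  fixes n :: "nat \<Rightarrow> nat"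
  assumes "i < p" "r < n i"
  shows "sum n {..<i} + r < sum n {..<p}"
proof -
  have "sum n {..<i} + n i = sum n {..<Suc i}" by simp
  also have "\<dots> \<le> sum n {..<p}" using assms by (intro sum_mono2) auto
  finally show ?thesis using assms by simp
qed

lemma sum_blocks:
  fixes f :: "nat \<Rightarrow> 'b::comm_monoid_add" and n :: "nat \<Rightarrow> nat"
  shows "(\<Sum>s<sum n {..<p}. f s) = (\<Sum>j<p. \<Sum>c<n j. f (sum n {..<j} + c))"
proof (induction p)
  case (Suc p)
  have "(\<Sum>s<k + l. f s) = (\<Sum>s<k. f s) + (\<Sum>c<l. f (k + c))" for k l
    by (induction l) (simp_all add: add.assoc)
  thus ?case using Suc by simp
qed simp

lemma dim_stack_rows:
  assumes "\<forall>B\<in>set Bs. dim_col B = m"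
  shows "dim_row (stack_rows m Bs) = sum_list (map dim_row Bs)" "dim_col (stack_rows m Bs) = m"
proof -
  have "dim_row (stack_rows m Bs) = sum_list (map dim_row Bs) \<and> dim_col (stack_rows m Bs) = m"
    using assms by (induction Bs) (auto simp: stack_rows_def append_rows_def)
  thus "dim_row (stack_rows m Bs) = sum_list (map dim_row Bs)" "dim_col (stack_rows m Bs) = m"
    by auto
qed

lemma stack_rows_entry:
  assumes "\<And>k. k < length Bs \<Longrightarrow> Bs ! k \<in> carrier_mat (n k) m"
    and "i < length Bs" "r < n i" "c < m"
  shows "stack_rows m Bs $$ (sum n {..<i} + r, c) = (Bs ! i) $$ (r, c)"
  using assms
proof (induction Bs arbitrary: i n)
  case (Cons B Bs)
  have B: "B \<in> carrier_mat (n 0) m" using Cons.prems(1)[of 0] by simp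
  have Bs: "Bs ! k \<in> carrier_mat (n (Suc k)) m" if "k < length Bs" for k
    using Cons.prems(1)[of "Suc k"] that by simp
  have "\<forall>B\<in>set Bs. dim_col B = m" using Bs by (metis carrier_matD(2) in_set_conv_nth)
  note dims = dim_stack_rows[OF this]
  have "map dim_row Bs = map (n \<circ> Suc) [0..<length Bs]"
    by (rule nth_equalityI) (use Bs in auto)
  hence rows: "dim_row (stack_rows m Bs) = sum (n \<circ> Suc) {..<length Bs}"
    unfolding dims by (simp add: sum_list_distinct_conv_sum_set atLeast0LessThan)
  have step: "stack_rows m (B # Bs) = B @\<^sub>r stack_rows m Bs" by (simp add: stack_rows_def)
  show ?case
  proof (cases i)
    case 0
    thus ?thesis using B Cons.prems dims unfolding step append_rows_def by auto
  next
    case (Suc j)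
    have IH: "stack_rows m Bs $$ (sum (n \<circ> Suc) {..<j} + r, c) = (Bs ! j) $$ (r, c)"
      by (rule Cons.IH) (use Bs Suc Cons.prems in auto)
    have less: "sum (n \<circ> Suc) {..<j} + r < sum (n \<circ> Suc) {..<length Bs}"
      by (rule block_index_less) (use Suc Cons.prems in auto)
    have off: "sum n {..<i} = n 0 + sum (n \<circ> Suc) {..<j}"
      unfolding Suc sum.lessThan_Suc_shift o_def ..
    show ?thesis using IH less B Cons.prems(4) Suc dims
      unfolding step append_rows_def off by (auto simp: rows)
  qed
qed simp

lemma diag_block_mat_entry:
  assumes "\<And>k. k < length As \<Longrightarrow> As ! k \<in> carrier_mat (n k) (n k)"
    and "i < length As" "r < n i" "j < length As" "c < n j"
  shows "diag_block_mat As $$ (sum n {..<i} + r, sum n {..<j} + c) =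
    (if i = j then (As ! i) $$ (r, c) else 0)"
  using assms
proof (induction As arbitrary: i j n)
  case (Cons A As)
  have A: "A \<in> carrier_mat (n 0) (n 0)" using Cons.prems(1)[of 0] by simp
  have As: "As ! k \<in> carrier_mat (n (Suc k)) (n (Suc k))" if "k < length As" for k
    using Cons.prems(1)[of "Suc k"] that by simp
  have "map dim_row As = map (n \<circ> Suc) [0..<length As]" "map dim_col As = map (n \<circ> Suc) [0..<length As]"
    by (rule nth_equalityI; use As in auto)+
  hence dims: "dim_row (diag_block_mat As) = sum (n \<circ> Suc) {..<length As}"
    "dim_col (diag_block_mat As) = sum (n \<circ> Suc) {..<length As}"
    unfolding dim_diag_block_mat by (simp_all add: sum_list_distinct_conv_sum_set atLeast0LessThan)
  have off: "sum n {..<Suc k} = n 0 + sum (n \<circ> Suc) {..<k}" for k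
    unfolding sum.lessThan_Suc_shift o_def ..
  have less: "sum (n \<circ> Suc) {..<k} + r < sum (n \<circ> Suc) {..<length As}"
    if "k < length As" "r < n (Suc k)" for k r
    by (rule block_index_less) (use that in auto)
  have IH: "diag_block_mat As $$ (sum (n \<circ> Suc) {..<i'} + r, sum (n \<circ> Suc) {..<j'} + c) =
    (if i' = j' then (As ! i') $$ (r, c) else 0)" if "i = Suc i'" "j = Suc j'" for i' j'
    by (rule Cons.IH) (use As that Cons.prems in auto)
  show ?case
    using A Cons.prems less[of "i - 1" r] less[of "j - 1" c] IH
    by (cases i; cases j) (auto simp: Let_def off dims simp del: sum.lessThan_Suc)
qed simp

context
  fixes m p :: nat and n :: "nat \<Rightarrow> nat"
    and AII AIG AGI AGG :: "nat \<Rightarrow> 'a::real_normed_field mat"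
  assumes AII: "\<And>i. i < p \<Longrightarrow> AII i \<in> carrier_mat (n i) (n i)"
    and AIG: "\<And>i. i < p \<Longrightarrow> AIG i \<in> carrier_mat (n i) m"
    and AGI: "\<And>i. i < p \<Longrightarrow> AGI i \<in> carrier_mat m (n i)"
begin

lemma diag_part_carrier: "diag_block_mat (map AII [0..<p]) \<in> carrier_mat (sum n {..<p}) (sum n {..<p})"
proof -
  have "map (dim_row \<circ> AII) [0..<p] = map n [0..<p]" "map (dim_col \<circ> AII) [0..<p] = map n [0..<p]"
    using carrier_matD[OF AII] by auto
  thus ?thesis
    by (intro carrier_matI)
       (simp_all add: dim_diag_block_mat sum_list_distinct_conv_sum_set atLeast0LessThan del: map_eq_conv)
qed

lemma global_mat_carrier:
  "global_mat m p AII AIG AGI AGG \<in> carrier_mat (sum n {..<p} + m) (sum n {..<p} + m)"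
  unfolding global_mat_def by (intro four_block_carrier_mat diag_part_carrier) (simp add: mat_sum_def)

lemma global_mat_entry_II:
  assumes "i < p" "r < n i" "j < p" "c < n j"
  shows "global_mat m p AII AIG AGI AGG $$ (sum n {..<i} + r, sum n {..<j} + c) =
    (if i = j then AII i $$ (r, c) else 0)"
proof -
  have "diag_block_mat (map AII [0..<p]) $$ (sum n {..<i} + r, sum n {..<j} + c) =
      (if i = j then map AII [0..<p] ! i $$ (r, c) else 0)"
    by (rule diag_block_mat_entry) (use assms AII in auto)
  thus ?thesis using assms diag_part_carrier block_index_less[of i p r n] block_index_less[of j p c n]
    unfolding global_mat_def by (simp add: mat_sum_def)
qed

lemma global_mat_entry_IG:
  assumes "i < p" "r < n i" "c < m"
  shows "global_mat m p AII AIG AGI AGG $$ (sum n {..<i} + r, sum n {..<p} + c) = AIG i $$ (r, c)"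
proof -
  have "stack_rows m (map AIG [0..<p]) $$ (sum n {..<i} + r, c) = map AIG [0..<p] ! i $$ (r, c)"
    by (rule stack_rows_entry) (use assms AIG in auto)
  thus ?thesis using assms diag_part_carrier block_index_less[of i p r n]
    unfolding global_mat_def by (simp add: mat_sum_def)
qed

lemma global_mat_entry_GI:
  assumes "r < m" "j < p" "c < n j"
  shows "global_mat m p AII AIG AGI AGG $$ (sum n {..<p} + r, sum n {..<j} + c) = AGI j $$ (r, c)"
proof -
  let ?Bs = "map transpose_mat (map AGI [0..<p])"
  have Bs: "?Bs ! k \<in> carrier_mat (n k) m" if "k < p" for k using that AGI by auto
  have "stack_rows m ?Bs $$ (sum n {..<j} + c, r) = ?Bs ! j $$ (c, r)"
    by (rule stack_rows_entry) (use assms Bs in auto)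
  moreover have "\<forall>B\<in>set ?Bs. dim_col B = m" using carrier_matD[OF AGI] by auto
  note dims = dim_stack_rows[OF this]
  have "map (dim_col \<circ> AGI) [0..<p] = map n [0..<p]" using carrier_matD[OF AGI] by auto
  hence "dim_row (stack_rows m ?Bs) = sum n {..<p}" unfolding dims
    by (simp add: sum_list_distinct_conv_sum_set atLeast0LessThan o_def del: map_eq_conv)
  ultimately show ?thesis using assms diag_part_carrier block_index_less[of j p c n] dims(2) AGI[of j]
    unfolding global_mat_def stack_cols_def by (simp add: mat_sum_def)
qed

lemma global_mat_entry_GG:
  assumes "r < m" "c < m"
  shows "global_mat m p AII AIG AGI AGG $$ (sum n {..<p} + r, sum n {..<p} + c) =
    mat_sum m p AGG $$ (r, c)"
  using assms diag_part_carrier unfolding global_mat_def by (simp add: mat_sum_def)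

text \<open>
  The weight vector of the block matrix is cut into its interior parts \<open>u j\<close> and its interface part
  \<open>v\<close>, which separates the dominance of the interior rows from that of the interface rows.
\<close>

lemma global_mat_block_dominance:
  assumes H: "H_matrix (global_mat m p AII AIG AGI AGG)"
  shows "\<exists>(u :: nat \<Rightarrow> nat \<Rightarrow> real) (v :: nat \<Rightarrow> real).
    (\<forall>j<p. \<forall>c<n j. u j c > 0) \<and> (\<forall>c<m. v c > 0) \<and>
    (\<forall>j<p. \<forall>r<n j.
       (\<Sum>c\<in>{..<n j} - {r}. norm (AII j $$ (r, c)) * u j c) + (\<Sum>c<m. norm (AIG j $$ (r, c)) * v c)
       < norm (AII j $$ (r, r)) * u j r) \<and>
    (\<forall>r<m.
       (\<Sum>j<p. \<Sum>c<n j. norm (AGI j $$ (r, c)) * u j c) +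
       (\<Sum>c\<in>{..<m} - {r}. norm (mat_sum m p AGG $$ (r, c)) * v c)
       < norm (mat_sum m p AGG $$ (r, r)) * v r)"
proof -
  define G where "G = global_mat m p AII AIG AGI AGG"
  define N where "N = sum n {..<p}"
  obtain w where w0: "\<And>r. r < N + m \<Longrightarrow> w r > 0" and
    dom: "\<And>r. r < N + m \<Longrightarrow>
      (\<Sum>s\<in>{..<N + m} - {r}. norm (G $$ (r, s)) * w s) < norm (G $$ (r, r)) * w r"
    using H_matrix_weighted_dominance[OF H global_mat_carrier] unfolding G_def N_def by blast
  \<comment> \<open>Adding the diagonal term to both sides turns the sums into sums over whole rows, which can be
    split along the blocks.\<close>
  have row: "(\<Sum>j<p. \<Sum>c<n j. norm (G $$ (r, sum n {..<j} + c)) * w (sum n {..<j} + c)) +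
      (\<Sum>c<m. norm (G $$ (r, N + c)) * w (N + c)) < 2 * (norm (G $$ (r, r)) * w r)"
    if "r < N + m" for r
  proof -
    have "(\<Sum>s<N + m. norm (G $$ (r, s)) * w s) =
        (\<Sum>s<N. norm (G $$ (r, s)) * w s) + (\<Sum>c<m. norm (G $$ (r, N + c)) * w (N + c))"
      by (induction m) (simp_all add: add.assoc)
    moreover have "(\<Sum>s<N + m. norm (G $$ (r, s)) * w s) < 2 * (norm (G $$ (r, r)) * w r)"
      using dom[OF that] that by (subst sum.remove[of _ r]) (auto simp: mult.commute)
    ultimately show ?thesis unfolding N_def sum_blocks by simp
  qed
  define u where "u = (\<lambda>j c. w (sum n {..<j} + c))"
  define v where "v = (\<lambda>c. w (N + c))"
  show ?thesis
  proof (intro exI[of _ u] exI[of _ v] conjI allI impI)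
    show "u j c > 0" if "j < p" "c < n j" for j c
      using w0 block_index_less[where n = n, OF that] by (simp add: u_def N_def)
    show "v c > 0" if "c < m" for c using w0 that by (simp add: v_def)
    show "(\<Sum>c\<in>{..<n j} - {r}. norm (AII j $$ (r, c)) * u j c) + (\<Sum>c<m. norm (AIG j $$ (r, c)) * v c)
       < norm (AII j $$ (r, r)) * u j r" if j: "j < p" and r: "r < n j" for j r
    proof -
      have "sum n {..<j} + r < N + m" using block_index_less[where n = n, OF j r] by (simp add: N_def)
      note R = row[OF this]
      have "(\<Sum>i<p. \<Sum>c<n i. norm (G $$ (sum n {..<j} + r, sum n {..<i} + c)) * w (sum n {..<i} + c)) =
          (\<Sum>i<p. if i = j then (\<Sum>c<n j. norm (AII j $$ (r, c)) * u j c) else 0)"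
        by (rule sum.cong) (use j r in \<open>auto simp: G_def global_mat_entry_II u_def\<close>)
      also have "\<dots> = (\<Sum>c<n j. norm (AII j $$ (r, c)) * u j c)" using j by simp
      also have "\<dots> = norm (AII j $$ (r, r)) * u j r + (\<Sum>c\<in>{..<n j} - {r}. norm (AII j $$ (r, c)) * u j c)"
        using r by (subst sum.remove[of _ r]) auto
      finally have 1: "(\<Sum>i<p. \<Sum>c<n i. norm (G $$ (sum n {..<j} + r, sum n {..<i} + c)) * w (sum n {..<i} + c)) =
         norm (AII j $$ (r, r)) * u j r + (\<Sum>c\<in>{..<n j} - {r}. norm (AII j $$ (r, c)) * u j c)" .
      have 2: "(\<Sum>c<m. norm (G $$ (sum n {..<j} + r, N + c)) * w (N + c)) =
          (\<Sum>c<m. norm (AIG j $$ (r, c)) * v c)"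
        by (rule sum.cong) (use j r in \<open>auto simp: G_def global_mat_entry_IG v_def N_def\<close>)
      have 3: "G $$ (sum n {..<j} + r, sum n {..<j} + r) = AII j $$ (r, r)"
        using j r by (simp add: G_def global_mat_entry_II)
      show ?thesis using R unfolding 1 2 3 by (simp add: u_def)
    qed
    show "(\<Sum>j<p. \<Sum>c<n j. norm (AGI j $$ (r, c)) * u j c) +
       (\<Sum>c\<in>{..<m} - {r}. norm (mat_sum m p AGG $$ (r, c)) * v c)
       < norm (mat_sum m p AGG $$ (r, r)) * v r" if r: "r < m" for r
    proof -
      have "N + r < N + m" using r by simp
      note R = row[OF this]
      have 1: "(\<Sum>j<p. \<Sum>c<n j. norm (G $$ (N + r, sum n {..<j} + c)) * w (sum n {..<j} + c)) =
          (\<Sum>j<p. \<Sum>c<n j. norm (AGI j $$ (r, c)) * u j c)"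
        by (intro sum.cong refl) (use r in \<open>auto simp: G_def global_mat_entry_GI u_def N_def\<close>)
      have "(\<Sum>c<m. norm (G $$ (N + r, N + c)) * w (N + c)) =
          (\<Sum>c<m. norm (mat_sum m p AGG $$ (r, c)) * v c)"
        by (intro sum.cong refl) (use r in \<open>auto simp: G_def global_mat_entry_GG v_def N_def\<close>)
      also have "\<dots> = norm (mat_sum m p AGG $$ (r, r)) * v r +
          (\<Sum>c\<in>{..<m} - {r}. norm (mat_sum m p AGG $$ (r, c)) * v c)"
        using r by (subst sum.remove[of _ r]) auto
      finally have 2: "(\<Sum>c<m. norm (G $$ (N + r, N + c)) * w (N + c)) =
          norm (mat_sum m p AGG $$ (r, r)) * v r +
          (\<Sum>c\<in>{..<m} - {r}. norm (mat_sum m p AGG $$ (r, c)) * v c)" .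
      have 3: "G $$ (N + r, N + r) = mat_sum m p AGG $$ (r, r)"
        using r by (simp add: G_def global_mat_entry_GG N_def)
      show ?thesis using R unfolding 1 2 3 by (simp add: v_def mult.commute)
    qed
  qed
qed

end

section \<open>Inverses and linear systems\<close>

lemma mat_inv_inverts:
  assumes A: "A \<in> carrier_mat n n" and inv: "invertible_mat A"
  shows "A * mat_inv A = 1\<^sub>m n" "mat_inv A \<in> carrier_mat n n"
proof -
  obtain B where B: "A * B = 1\<^sub>m n" "B * A = 1\<^sub>m (dim_row B)"
    using inv A unfolding invertible_mat_def inverts_mat_def by auto
  have "B \<in> carrier_mat n n"
    using arg_cong[OF B(1), of dim_col] arg_cong[OF B(2), of dim_col] A by auto
  hence "A \<in> Units (ring_mat TYPE('a) n ())"
    using A B unfolding Units_def by (auto simp: ring_mat_simps)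
  then obtain C where "mat_inverse A = Some C"
    using mat_inverse(1)[OF A, where b = "()"] by (cases "mat_inverse A") auto
  thus "A * mat_inv A = 1\<^sub>m n" "mat_inv A \<in> carrier_mat n n"
    using mat_inverse(2)[OF A] by (auto simp: mat_inv_def)
qed

lemma mult_mat_inv_vec:
  assumes A: "A \<in> carrier_mat n n" and inv: "invertible_mat A" and b: "b \<in> carrier_vec n"
  shows "A *\<^sub>v (mat_inv A *\<^sub>v b) = b"
  using assoc_mult_mat_vec[OF A mat_inv_inverts(2)[OF A inv] b] mat_inv_inverts(1)[OF A inv] b
  by simp

lemma mat_mult_vec_entry:
  assumes "A \<in> carrier_mat nr nc" "x \<in> carrier_vec nc" "r < nr"
  shows "(A *\<^sub>v x) $ r = (\<Sum>c<nc. A $$ (r, c) * x $ c)"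
  using assms by (simp add: scalar_prod_def atLeast0LessThan)

lemma diagonal_mat_inv_vec:
  assumes M: "M \<in> carrier_mat m m" and inv: "invertible_mat M" and d: "diagonal_mat M"
    and b: "b \<in> carrier_vec m" and r: "r < m"
  shows "M $$ (r, r) \<noteq> 0" "(mat_inv M *\<^sub>v b) $ r = b $ r / M $$ (r, r)"
proof -
  have row: "(M *\<^sub>v x) $ r = M $$ (r, r) * x $ r" if x: "x \<in> carrier_vec m" for x
  proof -
    have "(M *\<^sub>v x) $ r = (\<Sum>c<m. if c = r then M $$ (r, r) * x $ r else 0)"
      unfolding mat_mult_vec_entry[OF M x r]
      by (rule sum.cong) (use d M r in \<open>auto simp: diagonal_mat_def\<close>)
    thus ?thesis using r by simp
  qed
  have solve: "M $$ (r, r) * (mat_inv M *\<^sub>v b) $ r = b $ r" if b: "b \<in> carrier_vec m" for b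
  proof -
    have "mat_inv M *\<^sub>v b \<in> carrier_vec m" using mat_inv_inverts(2)[OF M inv] b by auto
    from row[OF this] show ?thesis unfolding mult_mat_inv_vec[OF M inv b] by simp
  qed
  show nz: "M $$ (r, r) \<noteq> 0" using solve[of "unit_vec m r"] r by auto
  show "(mat_inv M *\<^sub>v b) $ r = b $ r / M $$ (r, r)" using solve[OF b] nz by (simp add: field_simps)
qed

lemma mat_sum_mult_vec_entry:
  assumes F: "\<And>i. i < p \<Longrightarrow> F i \<in> carrier_mat m m" and z: "z \<in> carrier_vec m" and r: "r < m"
  shows "(mat_sum m p F *\<^sub>v z) $ r = (\<Sum>i<p. (F i *\<^sub>v z) $ r)"
proof -
  have S: "mat_sum m p F \<in> carrier_mat m m" by (simp add: mat_sum_def)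
  have "(mat_sum m p F *\<^sub>v z) $ r = (\<Sum>c<m. \<Sum>i<p. F i $$ (r, c) * z $ c)"
    unfolding mat_mult_vec_entry[OF S z r] using r by (simp add: mat_sum_def sum_distrib_right)
  also have "\<dots> = (\<Sum>i<p. \<Sum>c<m. F i $$ (r, c) * z $ c)" by (rule sum.swap)
  also have "\<dots> = (\<Sum>i<p. (F i *\<^sub>v z) $ r)"
    by (rule sum.cong) (use mat_mult_vec_entry[OF F z r] in auto)
  finally show ?thesis .
qed

lemma unique_solution_if_kernel_trivial:
  fixes S :: "'a::field mat"
  assumes S: "S \<in> carrier_mat m m" and b: "b \<in> carrier_vec m"
    and ker: "\<And>z. z \<in> carrier_vec m \<Longrightarrow> S *\<^sub>v z = 0\<^sub>v m \<Longrightarrow> z = 0\<^sub>v m"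
  shows "\<exists>!z. z \<in> carrier_vec m \<and> S *\<^sub>v z = b"
proof -
  have "det S \<noteq> 0" using det_0_iff_vec_prod_zero_field[OF S] ker by auto
  from det_non_zero_imp_unit[OF S this, of undefined]
  obtain B where B: "B \<in> carrier_mat m m" "S * B = 1\<^sub>m m" "B * S = 1\<^sub>m m"
    unfolding Units_def by (auto simp: ring_mat_simps)
  show ?thesis
  proof (rule ex1I[of _ "B *\<^sub>v b"])
    show "B *\<^sub>v b \<in> carrier_vec m \<and> S *\<^sub>v (B *\<^sub>v b) = b"
      using assoc_mult_mat_vec[OF S B(1) b] B b by auto
    show "z = B *\<^sub>v b" if "z \<in> carrier_vec m \<and> S *\<^sub>v z = b" for z
      using assoc_mult_mat_vec[OF B(1) S, of z] B that by auto
  qed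
qed

section \<open>Solutions of diagonally dominant systems\<close>

text \<open>
  A maximum principle: at an index where \<open>\<bar>w\<bar> / u\<close> attains its maximum \<open>t\<close>, the assumption
  \<open>t > e\<close> would let the right-hand side and the off-diagonal terms together fall short of the
  diagonal term. It plays the part of the inequality \<open>\<bar>A\<^bsup>-1\<^esup>\<bar> \<le> \<langle>A\<rangle>\<^bsup>-1\<^esup>\<close> for \<open>H\<close>-matrices.
\<close>

lemma dominant_solution_bound:
  fixes A :: "'a::real_normed_field mat"
  assumes A: "A \<in> carrier_mat n n" and w: "w \<in> carrier_vec n"
    and u: "\<And>r. r < n \<Longrightarrow> u r > 0"
    and dom: "\<And>r. r < n \<Longrightarrow>
      (\<Sum>c\<in>{..<n} - {r}. norm (A $$ (r, c)) * u c) + g r < norm (A $$ (r, r)) * u r"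
    and g: "\<And>r. r < n \<Longrightarrow> g r \<ge> 0" and e: "e \<ge> 0"
    and rhs: "\<And>r. r < n \<Longrightarrow> norm ((A *\<^sub>v w) $ r) \<le> e * g r"
    and s: "s < n"
  shows "norm (w $ s) \<le> e * u s"
proof -
  define t where "t = Max ((\<lambda>r. norm (w $ r) / u r) ` {..<n})"
  have "t \<in> (\<lambda>r. norm (w $ r) / u r) ` {..<n}" unfolding t_def using s by (intro Max_in) auto
  then obtain r where r: "r < n" "t = norm (w $ r) / u r" by auto
  have le: "norm (w $ c) \<le> t * u c" if "c < n" for c
  proof -
    have "norm (w $ c) / u c \<le> t" unfolding t_def using that by (intro Max_ge) auto
    thus ?thesis using u[OF that] by (simp add: field_simps)
  qed
  have "t \<le> e"
  proof (rule ccontr)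
    assume "\<not> t \<le> e"
    hence t: "e < t" "0 < t" using e by auto
    have wr: "norm (w $ r) = t * u r" using r u[OF r(1)] by simp
    have "A $$ (r, r) * w $ r = (A *\<^sub>v w) $ r - (\<Sum>c\<in>{..<n} - {r}. A $$ (r, c) * w $ c)"
      unfolding mat_mult_vec_entry[OF A w r(1)] using r by (subst sum.remove[of _ r]) auto
    hence "norm (A $$ (r, r) * w $ r) \<le>
        norm ((A *\<^sub>v w) $ r) + norm (\<Sum>c\<in>{..<n} - {r}. A $$ (r, c) * w $ c)"
      by (simp add: norm_triangle_ineq4)
    also have "\<dots> \<le> e * g r + (\<Sum>c\<in>{..<n} - {r}. norm (A $$ (r, c)) * (t * u c))"
      by (intro add_mono rhs r sum_norm_le) (auto simp: norm_mult intro!: mult_left_mono le)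
    also have "\<dots> \<le> t * g r + (\<Sum>c\<in>{..<n} - {r}. norm (A $$ (r, c)) * (t * u c))"
      using t g[OF r(1)] by (simp add: mult_right_mono)
    also have "\<dots> = t * ((\<Sum>c\<in>{..<n} - {r}. norm (A $$ (r, c)) * u c) + g r)"
      by (simp add: sum_distrib_left algebra_simps)
    also have "\<dots> < t * (norm (A $$ (r, r)) * u r)" using dom[OF r(1)] t by simp
    finally show False by (simp add: norm_mult wr mult_ac)
  qed
  thus ?thesis using le[OF s] u[OF s] by (meson mult_right_mono order.strict_implies_order order_trans)
qed

section \<open>Convergence of asynchronous contractions\<close>

text \<open>
  Only bounds on errors are mentioned, not the iteration that produces them: \<open>E i k r\<close> stands for the
  modulus of component \<open>r\<close> of the error of process \<open>i\<close> at step \<open>k\<close>. Some level \<open>C v\<close> bounds all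
  errors at all times. If from step \<open>K\<close> on the errors are bounded by \<open>c\<^sup>l C v\<close>, then from some step
  \<open>L\<close> on only data of step \<open>K\<close> or later are read, so an update brings the error of a process
  down to \<open>c\<^bsup>l + 1\<^esup> C v\<close>, where it stays.
\<close>

lemma asynchronous_contraction:
  fixes E :: "nat \<Rightarrow> nat \<Rightarrow> nat \<Rightarrow> real" and v :: "nat \<Rightarrow> real"
  assumes E: "\<And>i k r. E i k r \<ge> 0" and v: "\<And>r. r < m \<Longrightarrow> v r > 0"
    and c: "0 \<le> c" "c < 1"
    and active: "\<And>i. i < p \<Longrightarrow> infinite {k. i \<in> P k}"
    and delay: "\<And>i j k. i < p \<Longrightarrow> j < p \<Longrightarrow> \<tau> i j k \<le> k"
    and fresh: "\<And>i j. i < p \<Longrightarrow> j < p \<Longrightarrow> filterlim (\<tau> i j) at_top sequentially"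
    and idle: "\<And>i k r. i < p \<Longrightarrow> r < m \<Longrightarrow> i \<notin> P k \<Longrightarrow> E i (Suc k) r = E i k r"
    and update: "\<And>i k r e. i < p \<Longrightarrow> r < m \<Longrightarrow> i \<in> P k \<Longrightarrow> 0 \<le> e \<Longrightarrow>
      (\<And>j s. j < p \<Longrightarrow> s < m \<Longrightarrow> E j (\<tau> i j k) s \<le> e * v s) \<Longrightarrow> E i (Suc k) r \<le> c * e * v r"
    and i: "i < p" and r: "r < m"
  shows "(\<lambda>k. E i k r) \<longlonglongrightarrow> 0"
proof -
  define C where "C = (\<Sum>i<p. \<Sum>r<m. E i 0 r / v r)"
  have C0: "C \<ge> 0" unfolding C_def using E v by (intro sum_nonneg divide_nonneg_nonneg) (auto intro: less_imp_le)
  have init: "E i 0 r \<le> C * v r" if "i < p" "r < m" for i r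
  proof -
    have nonneg: "0 \<le> E i 0 r / v r" if "r < m" for i r
      using E v[OF that] by simp
    have "E i 0 r / v r \<le> (\<Sum>r<m. E i 0 r / v r)"
      by (rule member_le_sum) (use that nonneg in auto)
    also have "\<dots> \<le> C" unfolding C_def
      by (rule member_le_sum) (use that nonneg in \<open>auto intro: sum_nonneg\<close>)
    finally show ?thesis using v[OF that(2)] by (simp add: field_simps)
  qed
  have all: "E i k r \<le> C * v r" if "i < p" "r < m" for i k r
    using that
  proof (induction k arbitrary: i r rule: less_induct)
    case (less k)
    show ?case
    proof (cases k)
      case 0
      thus ?thesis using init less.prems by simp
    next
      case (Suc l)
      show ?thesis
      proof (cases "i \<in> P l")
        case False
        thus ?thesis using idle less Suc by simp
      next
        case True
        have "E i (Suc l) r \<le> c * C * v r"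
        proof (rule update[OF less.prems True C0])
          fix j s assume js: "j < p" "s < m"
          have "\<tau> i j l < k" using delay[OF less.prems(1) js(1), of l] Suc by simp
          thus "E j (\<tau> i j l) s \<le> C * v s" using less.IH js by blast
        qed
        also have "\<dots> \<le> 1 * C * v r"
          using c C0 v[OF less.prems(2)] by (intro mult_right_mono) auto
        finally show ?thesis using Suc by simp
      qed
    qed
  qed
  have level: "\<exists>K. \<forall>k\<ge>K. \<forall>i<p. \<forall>r<m. E i k r \<le> c ^ l * C * v r" for l
  proof (induction l)
    case 0
    thus ?case using all by auto
  next
    case (Suc l)
    then obtain K where K: "\<And>k i r. k \<ge> K \<Longrightarrow> i < p \<Longrightarrow> r < m \<Longrightarrow> E i k r \<le> c ^ l * C * v r"
      by blast
    have e0: "0 \<le> c ^ l * C" using c C0 by simp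
    have "\<forall>\<^sub>F k in sequentially. \<forall>i<p. \<forall>j<p. K \<le> \<tau> i j k"
    proof -
      have "\<forall>\<^sub>F k in sequentially. \<forall>i\<in>{..<p}. \<forall>j\<in>{..<p}. K \<le> \<tau> i j k"
        using fresh by (intro eventually_ball_finite ballI) (auto simp: filterlim_at_top)
      thus ?thesis by (rule eventually_mono) auto
    qed
    then obtain L where L: "\<And>k i j. k \<ge> L \<Longrightarrow> i < p \<Longrightarrow> j < p \<Longrightarrow> K \<le> \<tau> i j k"
      unfolding eventually_sequentially by blast
    have active_step: "E i (Suc k) r \<le> c ^ Suc l * C * v r"
      if "k \<ge> L" "i < p" "r < m" "i \<in> P k" for i k r
      using update[OF that(2-4) e0] K L[OF that(1,2)] by (simp add: mult.assoc)
    \<comment> \<open>\<open>f i\<close> is a step not before \<open>L\<close> at which process \<open>i\<close> is updated.\<close>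
    have "\<forall>i\<in>{..<p}. \<exists>k\<ge>L. i \<in> P k"
    proof
      fix i assume "i \<in> {..<p}"
      thus "\<exists>k\<ge>L. i \<in> P k" using active[of i] unfolding infinite_nat_iff_unbounded_le by auto
    qed
    then obtain f where f: "\<And>i. i < p \<Longrightarrow> f i \<ge> L \<and> i \<in> P (f i)" by (metis lessThan_iff)
    have late: "E i k r \<le> c ^ Suc l * C * v r" if i: "i < p" and r: "r < m" and k: "Suc (f i) \<le> k" for i k r
      using k
    proof (induction k rule: dec_induct)
      case base
      show ?case using active_step f i r by blast
    next
      case (step k)
      thus ?case using active_step[of k i r] idle[OF i r, of k] f[OF i] i r
        by (cases "i \<in> P k") auto
    qed
    define K' where "K' = (\<Sum>i<p. Suc (f i))"
    have "Suc (f i) \<le> K'" if "i < p" for i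
      unfolding K'_def by (rule member_le_sum) (use that in auto)
    thus ?case using late by (meson le_trans)
  qed
  show ?thesis
  proof (rule LIMSEQ_I)
    fix d :: real assume d: "d > 0"
    have "(\<lambda>l. c ^ l * (C * v r)) \<longlonglongrightarrow> 0 * (C * v r)"
      using c by (intro tendsto_mult_right LIMSEQ_realpow_zero)
    hence "\<forall>\<^sub>F l in sequentially. c ^ l * (C * v r) < d" using d by (intro order_tendstoD) auto
    then obtain l where l: "c ^ l * (C * v r) < d" by (auto simp: eventually_sequentially)
    obtain K where "\<forall>k\<ge>K. \<forall>i<p. \<forall>r<m. E i k r \<le> c ^ l * C * v r" using level by blast
    hence "norm (E i k r - 0) < d" if "k \<ge> K" for k
      using that i r l E[of i k r] by (fastforce simp: mult.assoc)
    thus "\<exists>K. \<forall>k\<ge>K. norm (E i k r - 0) < d" by blast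
  qed
qed

section \<open>Contraction of the local errors\<close>

locale schur_setting =
  fixes m p :: nat and n :: "nat \<Rightarrow> nat"
    and AII AIG AGI AGG J :: "nat \<Rightarrow> 'a::real_normed_field mat"
    and M :: "'a mat"
    and W :: "nat \<Rightarrow> real mat"
  assumes AII: "\<And>i. i < p \<Longrightarrow> AII i \<in> carrier_mat (n i) (n i)"
    and AII_inv: "\<And>i. i < p \<Longrightarrow> invertible_mat (AII i)"
    and AIG: "\<And>i. i < p \<Longrightarrow> AIG i \<in> carrier_mat (n i) m"
    and AGI: "\<And>i. i < p \<Longrightarrow> AGI i \<in> carrier_mat m (n i)"
    and AGG: "\<And>i. i < p \<Longrightarrow> AGG i \<in> carrier_mat m m"
    and M: "M \<in> carrier_mat m m" and M_inv: "invertible_mat M"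
    and J: "\<And>i. i < p \<Longrightarrow> J i \<in> carrier_mat m m"
    and J_sum: "mat_sum m p J = 1\<^sub>m m"
    and W: "\<And>i. i < p \<Longrightarrow> W i \<in> carrier_mat m m"
    and W_nonneg: "\<And>i. i < p \<Longrightarrow> 0\<^sub>m m m \<le> W i"
    and AGG_W: "\<And>i. i < p \<Longrightarrow> AGG i = hadamard (W i) (mat_sum m p AGG)"
    and J_W: "\<And>i. i < p \<Longrightarrow> J i = hadamard (W i) (1\<^sub>m m)"
    and H: "H_matrix (global_mat m p AII AIG AGI AGG)"
    and M_diag: "diagonal_mat M"
    and M_split: "comparison_mat M - abs_mat (M - mat_sum m p AGG) = comparison_mat (mat_sum m p AGG)"
begin

abbreviation "A \<equiv> mat_sum m p AGG"
abbreviation "S \<equiv> schur_mat AII AIG AGI AGG"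

lemma A_carrier: "A \<in> carrier_mat m m" by (simp add: mat_sum_def)

lemma W_entry_nonneg:
  assumes "i < p" "r < m" "c < m"
  shows "W i $$ (r, c) \<ge> 0"
  using W_nonneg[OF assms(1)] carrier_matD[OF W[OF assms(1)]] assms(2,3)
  by (auto simp: less_eq_mat_def)

lemma J_entry: "i < p \<Longrightarrow> r < m \<Longrightarrow> c < m \<Longrightarrow> J i $$ (r, c) = (if r = c then of_real (W i $$ (r, c)) else 0)"
  using J_W[of i] by (simp add: hadamard_def)

lemma AGG_entry: "i < p \<Longrightarrow> r < m \<Longrightarrow> c < m \<Longrightarrow> AGG i $$ (r, c) = of_real (W i $$ (r, c)) * A $$ (r, c)"
  using arg_cong[OF AGG_W[of i], of "\<lambda>B. B $$ (r, c)"] A_carrier by (simp add: hadamard_def)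

lemma M_offdiag: "r < m \<Longrightarrow> c < m \<Longrightarrow> r \<noteq> c \<Longrightarrow> M $$ (r, c) = 0"
  using M_diag M by (simp add: diagonal_mat_def)

lemma M_diag_nonzero: "r < m \<Longrightarrow> M $$ (r, r) \<noteq> 0"
  using diagonal_mat_inv_vec(1)[OF M M_inv M_diag zero_carrier_vec] .

lemma W_sum_diag:
  assumes "r < m"
  shows "(\<Sum>i<p. W i $$ (r, r)) = 1"
proof -
  have "(of_real (\<Sum>i<p. W i $$ (r, r)) :: 'a) = (\<Sum>i<p. J i $$ (r, r))"
    using assms by (simp add: J_entry)
  also have "\<dots> = mat_sum m p J $$ (r, r)" using assms by (simp add: mat_sum_def)
  also have "\<dots> = 1" using assms by (simp add: J_sum)
  finally show ?thesis by (metis of_real_eq_1_iff)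
qed

text \<open>
  The local blocks add up to \<open>A\<close>, so the sum of the weights multiplies each entry of \<open>A\<close> by 1.
  Where an off-diagonal entry of \<open>A\<close> vanishes, nothing is known about this sum.
\<close>

lemma W_sum_where_nonzero:
  assumes "r < m" "c < m" "A $$ (r, c) \<noteq> 0"
  shows "(\<Sum>i<p. W i $$ (r, c)) = 1"
proof -
  have "A $$ (r, c) = (\<Sum>i<p. AGG i $$ (r, c))" using assms by (simp add: mat_sum_def)
  also have "\<dots> = (\<Sum>i<p. of_real (W i $$ (r, c)) * A $$ (r, c))"
    using assms(1,2) by (intro sum.cong refl) (simp add: AGG_entry)
  also have "\<dots> = of_real (\<Sum>i<p. W i $$ (r, c)) * A $$ (r, c)" by (simp add: sum_distrib_right)
  finally have "(of_real (\<Sum>i<p. W i $$ (r, c)) :: 'a) = 1" using assms(3) by simp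
  thus ?thesis by (metis of_real_eq_1_iff)
qed

text \<open>
  Off the diagonal this holds because \<open>M\<close> vanishes there; on the diagonal it is the assumption that
  links \<open>M\<close> to the comparison matrices.
\<close>

lemma split_norm:
  assumes "r < m" "c < m"
  shows "norm (M $$ (r, c) - A $$ (r, c)) =
    (if r = c then norm (M $$ (r, r)) - norm (A $$ (r, r)) else norm (A $$ (r, c)))"
proof -
  have "(comparison_mat M - abs_mat (M - A)) $$ (r, c) = comparison_mat A $$ (r, c)"
    using M_split by simp
  thus ?thesis using assms M A_carrier M_offdiag[of r c]
    by (auto simp: comparison_mat_def abs_mat_def split: if_splits)
qed

text \<open>
  The weights distribute \<open>\<bar>M - A\<bar>\<close> over the subdomains without changing its total, since they
  add up to 1 wherever \<open>M - A\<close> can be non-zero. The right-hand side is row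
  \<open>r\<close> of \<open>\<bar>M\<bar> v - \<langle>A\<rangle> v\<close>.
\<close>

lemma split_row_sum:
  fixes v :: "nat \<Rightarrow> real"
  assumes r: "r < m"
  shows "(\<Sum>j<p. \<Sum>c<m. W j $$ (r, c) * norm (M $$ (r, c) - A $$ (r, c)) * v c) =
    norm (M $$ (r, r)) * v r - norm (A $$ (r, r)) * v r +
    (\<Sum>c\<in>{..<m} - {r}. norm (A $$ (r, c)) * v c)"
proof -
  have "(\<Sum>j<p. \<Sum>c<m. W j $$ (r, c) * norm (M $$ (r, c) - A $$ (r, c)) * v c) =
      (\<Sum>c<m. (\<Sum>j<p. W j $$ (r, c)) * norm (M $$ (r, c) - A $$ (r, c)) * v c)"
    by (subst sum.swap) (simp add: sum_distrib_right)
  also have "\<dots> = (\<Sum>c<m. norm (M $$ (r, c) - A $$ (r, c)) * v c)"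
  proof (rule sum.cong)
    fix c assume "c \<in> {..<m}"
    hence c: "c < m" by simp
    show "(\<Sum>j<p. W j $$ (r, c)) * norm (M $$ (r, c) - A $$ (r, c)) * v c =
        norm (M $$ (r, c) - A $$ (r, c)) * v c"
      using W_sum_diag[OF r] W_sum_where_nonzero[OF r c] split_norm[OF r c]
      by (cases "r = c"; cases "A $$ (r, c) = 0") auto
  qed simp
  also have "\<dots> = norm (M $$ (r, r) - A $$ (r, r)) * v r +
      (\<Sum>c\<in>{..<m} - {r}. norm (M $$ (r, c) - A $$ (r, c)) * v c)"
    using r by (subst sum.remove[of _ r]) auto
  also have "(\<Sum>c\<in>{..<m} - {r}. norm (M $$ (r, c) - A $$ (r, c)) * v c) =
      (\<Sum>c\<in>{..<m} - {r}. norm (A $$ (r, c)) * v c)"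
    by (rule sum.cong) (use r split_norm[OF r] in auto)
  finally show ?thesis using split_norm[OF r r] by (simp add: algebra_simps)
qed

lemma S_carrier: "i < p \<Longrightarrow> S i \<in> carrier_mat m m"
  using mat_inv_inverts(2)[OF AII AII_inv] AIG[of i] AGI[of i] AGG[of i] AII[of i]
  unfolding schur_mat_def by auto

text \<open>
  Up to the sign, the interior unknowns of subdomain \<open>j\<close> that solve the homogeneous interior
  equations for the interface values \<open>e\<close>.
\<close>

definition interior_response :: "nat \<Rightarrow> 'a vec \<Rightarrow> 'a vec" where
  "interior_response j e = mat_inv (AII j) *\<^sub>v (AIG j *\<^sub>v e)"

lemma interior_response_carrier: "j < p \<Longrightarrow> e \<in> carrier_vec m \<Longrightarrow> interior_response j e \<in> carrier_vec (n j)"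
  unfolding interior_response_def using mat_inv_inverts(2)[OF AII AII_inv, of j] AIG[of j] by auto

lemma S_mult_vec:
  assumes j: "j < p" and e: "e \<in> carrier_vec m" and r: "r < m"
  shows "(S j *\<^sub>v e) $ r = (AGG j *\<^sub>v e) $ r - (AGI j *\<^sub>v interior_response j e) $ r"
proof -
  note I = mat_inv_inverts(2)[OF AII[OF j] AII_inv[OF j]]
  have GI: "AGI j * mat_inv (AII j) \<in> carrier_mat m (n j)" using I AGI[OF j] by auto
  have G: "AGI j * mat_inv (AII j) * AIG j \<in> carrier_mat m m" using GI AIG[OF j] by auto
  have "(AGI j * mat_inv (AII j) * AIG j) *\<^sub>v e = AGI j *\<^sub>v interior_response j e"
    unfolding interior_response_def assoc_mult_mat_vec[OF GI AIG[OF j] e]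
    by (rule assoc_mult_mat_vec[OF AGI[OF j] I]) (use AIG[OF j] e in auto)
  moreover have "S j *\<^sub>v e = AGG j *\<^sub>v e - (AGI j * mat_inv (AII j) * AIG j) *\<^sub>v e"
    unfolding schur_mat_def by (rule minus_mult_distrib_mat_vec[OF AGG[OF j] G e])
  ultimately show ?thesis using r AGG[OF j] AGI[OF j] by simp
qed

text \<open>
  Component \<open>r\<close> of \<open>(J\<^sub>j - M\<^bsup>-1\<^esup> S\<^sub>j) e\<close> for diagonal \<open>M\<close>: the change of the contribution of
  subdomain \<open>j\<close> when its interface vector changes by \<open>e\<close>.
\<close>

definition local_error :: "nat \<Rightarrow> 'a vec \<Rightarrow> nat \<Rightarrow> 'a" where
  "local_error j e r = (J j *\<^sub>v e) $ r - (S j *\<^sub>v e) $ r / M $$ (r, r)"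

text \<open>
  After multiplication by \<open>M\<^sub>r\<^sub>r\<close> the local error is the sum of \<open>W\<^sub>j \<circ> (M - A)\<close> applied to \<open>e\<close> and of
  \<open>A\<^sub>\<Gamma>\<^sub>I\<close> applied to the interior response, which the dominance of the interior rows bounds
  by \<open>t u\<close>.
\<close>

lemma local_error_bound:
  assumes j: "j < p" and e: "e \<in> carrier_vec m" and r: "r < m" and t: "t \<ge> 0"
    and v: "\<And>c. c < m \<Longrightarrow> norm (e $ c) \<le> t * v c"
    and v0: "\<And>c. c < m \<Longrightarrow> v c > 0" and u: "\<And>c. c < n j \<Longrightarrow> u c > 0"
    and dom: "\<And>r. r < n j \<Longrightarrow>
       (\<Sum>c\<in>{..<n j} - {r}. norm (AII j $$ (r, c)) * u c) + (\<Sum>c<m. norm (AIG j $$ (r, c)) * v c)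
       < norm (AII j $$ (r, r)) * u r"
  shows "norm (local_error j e r) \<le> t / norm (M $$ (r, r)) *
    ((\<Sum>c<m. W j $$ (r, c) * norm (M $$ (r, c) - A $$ (r, c)) * v c) +
     (\<Sum>c<n j. norm (AGI j $$ (r, c)) * u c))"
proof -
  note w = interior_response_carrier[OF j e]
  have AIGe: "AIG j *\<^sub>v e \<in> carrier_vec (n j)" using AIG[OF j] e by auto
  have solves: "AII j *\<^sub>v interior_response j e = AIG j *\<^sub>v e"
    unfolding interior_response_def by (rule mult_mat_inv_vec[OF AII[OF j] AII_inv[OF j] AIGe])
  have int: "norm (interior_response j e $ c) \<le> t * u c" if c: "c < n j" for c
  proof (rule dominant_solution_bound[OF AII[OF j] w u dom _ t _ c])
    fix s assume s: "s < n j"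
    show "(\<Sum>c<m. norm (AIG j $$ (s, c)) * v c) \<ge> 0"
      using v0 by (intro sum_nonneg mult_nonneg_nonneg) (auto intro: less_imp_le)
    have "norm ((AIG j *\<^sub>v e) $ s) \<le> (\<Sum>c<m. norm (AIG j $$ (s, c)) * (t * v c))"
      unfolding mat_mult_vec_entry[OF AIG[OF j] e s]
      by (intro sum_norm_le) (auto simp: norm_mult intro!: mult_left_mono v)
    thus "norm ((AII j *\<^sub>v interior_response j e) $ s) \<le> t * (\<Sum>c<m. norm (AIG j $$ (s, c)) * v c)"
      unfolding solves by (simp add: sum_distrib_left mult_ac)
  qed
  note Mr = M_diag_nonzero[OF r]
  have "M $$ (r, r) * (J j *\<^sub>v e) $ r - (AGG j *\<^sub>v e) $ r =
      (\<Sum>c<m. of_real (W j $$ (r, c)) * (M $$ (r, c) - A $$ (r, c)) * e $ c)"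
    unfolding mat_mult_vec_entry[OF J[OF j] e r] mat_mult_vec_entry[OF AGG[OF j] e r]
      sum_distrib_left sum_subtractf[symmetric]
    by (rule sum.cong) (use j r in \<open>auto simp: J_entry AGG_entry M_offdiag algebra_simps\<close>)
  hence "M $$ (r, r) * local_error j e r =
      (\<Sum>c<m. of_real (W j $$ (r, c)) * (M $$ (r, c) - A $$ (r, c)) * e $ c) +
      (\<Sum>c<n j. AGI j $$ (r, c) * interior_response j e $ c)"
    unfolding local_error_def S_mult_vec[OF j e r] mat_mult_vec_entry[OF AGI[OF j] w r, symmetric]
    using Mr by (simp add: field_simps)
  hence "norm (M $$ (r, r)) * norm (local_error j e r) =
      norm ((\<Sum>c<m. of_real (W j $$ (r, c)) * (M $$ (r, c) - A $$ (r, c)) * e $ c) +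
      (\<Sum>c<n j. AGI j $$ (r, c) * interior_response j e $ c))"
    by (metis norm_mult)
  also have "\<dots> \<le> (\<Sum>c<m. W j $$ (r, c) * norm (M $$ (r, c) - A $$ (r, c)) * (t * v c)) +
      (\<Sum>c<n j. norm (AGI j $$ (r, c)) * (t * u c))"
    using W_entry_nonneg[OF j r]
    by (intro norm_triangle_le add_mono sum_norm_le)
       (auto simp: norm_mult intro!: mult_left_mono v int mult_nonneg_nonneg)
  also have "\<dots> = t * ((\<Sum>c<m. W j $$ (r, c) * norm (M $$ (r, c) - A $$ (r, c)) * v c) +
     (\<Sum>c<n j. norm (AGI j $$ (r, c)) * u c))"
    by (simp add: sum_distrib_left algebra_simps)
  finally show ?thesis using Mr by (simp add: field_simps)
qed

text \<open>
  The vectors \<open>e j\<close> may differ from subdomain to subdomain: a contraction of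
  \<open>\<Sum>\<^sub>j (J\<^sub>j - M\<^bsup>-1\<^esup> S\<^sub>j)\<close> applied to a common vector would not control an update
  from data of different steps.
\<close>

lemma contraction:
  "\<exists>k v. 0 \<le> k \<and> k < 1 \<and> (\<forall>c<m. v c > 0) \<and>
    (\<forall>e t r. t \<ge> 0 \<longrightarrow> r < m \<longrightarrow>
      (\<forall>j<p. e j \<in> carrier_vec m \<and> (\<forall>c<m. norm (e j $ c) \<le> t * v c)) \<longrightarrow>
      norm (\<Sum>j<p. local_error j (e j) r) \<le> k * t * v r)"
proof -
  obtain u v where pos: "\<forall>j<p. \<forall>c<n j. u j c > 0" "\<forall>c<m. v c > 0"
    and dom:
    "\<forall>j<p. \<forall>r<n j.
       (\<Sum>c\<in>{..<n j} - {r}. norm (AII j $$ (r, c)) * u j c) + (\<Sum>c<m. norm (AIG j $$ (r, c)) * v c)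
       < norm (AII j $$ (r, r)) * u j r"
    "\<forall>r<m.
       (\<Sum>j<p. \<Sum>c<n j. norm (AGI j $$ (r, c)) * u j c) +
       (\<Sum>c\<in>{..<m} - {r}. norm (A $$ (r, c)) * v c) < norm (A $$ (r, r)) * v r"
    using global_mat_block_dominance[where p = p and n = n, OF AII AIG AGI H] by blast
  note u = pos(1)[rule_format] and v = pos(2)[rule_format]
    and domI = dom(1)[rule_format] and domG = dom(2)[rule_format]
  \<comment> \<open>the factor that the bounds of the local errors give for row \<open>r\<close>\<close>
  define q where "q = (\<lambda>r. (\<Sum>j<p. (\<Sum>c<m. W j $$ (r, c) * norm (M $$ (r, c) - A $$ (r, c)) * v c) +
     (\<Sum>c<n j. norm (AGI j $$ (r, c)) * u j c)) / (norm (M $$ (r, r)) * v r))"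
  \<comment> \<open>The maximum includes 0 so that it exists for an empty interface and is never negative.\<close>
  define k where "k = Max (insert 0 (q ` {..<m}))"
  have q1: "q r < 1" if r: "r < m" for r
  proof -
    have "(\<Sum>j<p. (\<Sum>c<m. W j $$ (r, c) * norm (M $$ (r, c) - A $$ (r, c)) * v c) +
        (\<Sum>c<n j. norm (AGI j $$ (r, c)) * u j c)) < norm (M $$ (r, r)) * v r"
      using domG[OF r] unfolding sum.distrib split_row_sum[OF r] by linarith
    thus ?thesis using v[OF r] M_diag_nonzero[OF r] by (simp add: q_def)
  qed
  have "norm (\<Sum>j<p. local_error j (e j) r) \<le> k * t * v r"
    if t: "t \<ge> 0" and r: "r < m"
      and e: "\<forall>j<p. e j \<in> carrier_vec m \<and> (\<forall>c<m. norm (e j $ c) \<le> t * v c)"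
    for e t r
  proof -
    have "norm (\<Sum>j<p. local_error j (e j) r) \<le> (\<Sum>j<p. t / norm (M $$ (r, r)) *
      ((\<Sum>c<m. W j $$ (r, c) * norm (M $$ (r, c) - A $$ (r, c)) * v c) +
       (\<Sum>c<n j. norm (AGI j $$ (r, c)) * u j c)))"
      by (intro sum_norm_le local_error_bound) (use e r t v u domI in auto)
    also have "\<dots> = q r * t * v r"
      unfolding sum_distrib_left[symmetric] using v[OF r] by (simp add: q_def)
    also have "\<dots> \<le> k * t * v r"
      using t v[OF r] r by (intro mult_right_mono) (auto simp: k_def)
    finally show ?thesis .
  qed
  moreover have "0 \<le> k" "k < 1" using q1 by (auto simp: k_def)
  ultimately show ?thesis using v by blast
qed

lemma sum_local_error:
  assumes z: "z \<in> carrier_vec m" and r: "r < m"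
  shows "(\<Sum>j<p. local_error j z r) = z $ r - (mat_sum m p S *\<^sub>v z) $ r / M $$ (r, r)"
proof -
  have "(\<Sum>j<p. (J j *\<^sub>v z) $ r) = z $ r"
    using mat_sum_mult_vec_entry[where F = J and p = p, OF J z r] z by (simp add: J_sum)
  moreover have "(\<Sum>j<p. (S j *\<^sub>v z) $ r) = (mat_sum m p S *\<^sub>v z) $ r"
    using mat_sum_mult_vec_entry[where F = S and p = p, OF S_carrier z r] by simp
  ultimately show ?thesis
    unfolding local_error_def sum_subtractf sum_divide_distrib[symmetric] by simp
qed

text \<open>
  For \<open>z\<close> in the kernel, \<open>z\<close> equals the sum of its own local errors, so the constant sequence \<open>z\<close>
  is an iteration of a single process that contracts at every step without delay; hence \<open>z = 0\<close>.
\<close>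

lemma schur_kernel_trivial:
  assumes z: "z \<in> carrier_vec m" and 0: "mat_sum m p S *\<^sub>v z = 0\<^sub>v m"
  shows "z = 0\<^sub>v m"
proof (rule eq_vecI)
  fix r assume "r < dim_vec (0\<^sub>v m :: 'a vec)"
  hence r: "r < m" by simp
  obtain k v where k: "0 \<le> k" "k < 1" and v: "\<And>c. c < m \<Longrightarrow> v c > 0"
    and contr: "\<forall>e t r. t \<ge> 0 \<longrightarrow> r < m \<longrightarrow>
      (\<forall>j<p. e j \<in> carrier_vec m \<and> (\<forall>c<m. norm (e j $ c) \<le> t * v c)) \<longrightarrow>
      norm (\<Sum>j<p. local_error j (e j) r) \<le> k * t * v r"
    using contraction by blast
  have "(\<lambda>l. norm (z $ r)) \<longlonglongrightarrow> 0"
  proof (rule asynchronous_contraction[where E = "\<lambda>i l s. norm (z $ s)" and m = m and p = 1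
        and P = "\<lambda>_. UNIV" and \<tau> = "\<lambda>i j k. k" and v = v and c = k and i = 0])
    fix i l s :: nat and t :: real
    assume s: "s < m" and t: "0 \<le> t"
      and le: "\<And>j s. j < (1::nat) \<Longrightarrow> s < m \<Longrightarrow> norm (z $ s) \<le> t * v s"
    have "z $ s = (\<Sum>j<p. local_error j z s)" using sum_local_error[OF z s] 0 s by simp
    also have "norm \<dots> \<le> k * t * v s"
      by (rule contr[rule_format, where e = "\<lambda>_. z", OF t s]) (use z le[of 0] in auto)
    finally show "norm (z $ s) \<le> k * t * v s" .
  qed (use k v r in \<open>auto simp: filterlim_ident\<close>)
  hence "norm (z $ r) = 0" by (simp add: LIMSEQ_const_iff)
  thus "z $ r = 0\<^sub>v m $ r" using r by simp
qed (use z in simp)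

end

section \<open>Convergence of the asynchronous Schur method\<close>

theorem corollary5:
  fixes m p :: nat and n :: "nat \<Rightarrow> nat"
    and AII AIG AGI AGG J :: "nat \<Rightarrow> 'a::real_normed_field mat"
    and M :: "'a mat"
    and bI bG :: "nat \<Rightarrow> 'a vec"
    and W :: "nat \<Rightarrow> real mat"
  assumes "\<And>i. i < p \<Longrightarrow> AII i \<in> carrier_mat (n i) (n i)"
    and "\<And>i. i < p \<Longrightarrow> invertible_mat (AII i)"
    and "\<And>i. i < p \<Longrightarrow> AIG i \<in> carrier_mat (n i) m"
    and "\<And>i. i < p \<Longrightarrow> AGI i \<in> carrier_mat m (n i)"
    and "\<And>i. i < p \<Longrightarrow> AGG i \<in> carrier_mat m m"
    and "\<And>i. i < p \<Longrightarrow> bI i \<in> carrier_vec (n i)"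
    and "\<And>i. i < p \<Longrightarrow> bG i \<in> carrier_vec m"
    and "M \<in> carrier_mat m m" and "invertible_mat M"
    and "\<And>i. i < p \<Longrightarrow> J i \<in> carrier_mat m m"
    and "mat_sum m p J = 1\<^sub>m m"
    and "\<And>i. i < p \<Longrightarrow> W i \<in> carrier_mat m m"
    and "\<And>i. i < p \<Longrightarrow> 0\<^sub>m m m \<le> W i"
    and "\<And>i. i < p \<Longrightarrow> AGG i = hadamard (W i) (mat_sum m p AGG)"
    and "\<And>i. i < p \<Longrightarrow> J i = hadamard (W i) (1\<^sub>m m)"
    and "H_matrix (global_mat m p AII AIG AGI AGG)"
    and "diagonal_mat M"
    and "comparison_mat M - abs_mat (M - mat_sum m p AGG) = comparison_mat (mat_sum m p AGG)"
  shows "async_schur_convergent m p (schur_mat AII AIG AGI AGG) (schur_rhs AII AGI bI bG) M J"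
proof -
  interpret schur_setting m p n AII AIG AGI AGG J M W
    by (rule schur_setting.intro) fact+
  define d where "d = schur_rhs AII AGI bI bG"
  define is_sol where "is_sol = (\<lambda>z. z \<in> carrier_vec m \<and>
    mat_sum m p S *\<^sub>v z = finsum_vec TYPE('a) m d {..<p})"
  have d: "d i \<in> carrier_vec m" if "i < p" for i
    using that assms(4,6,7)[OF that] mat_inv_inverts(2)[OF AII AII_inv, OF that that]
    unfolding d_def schur_rhs_def by auto
  have Ssum: "mat_sum m p S \<in> carrier_mat m m" by (simp add: mat_sum_def)
  have rhs: "finsum_vec TYPE('a) m d {..<p} \<in> carrier_vec m"
    by (rule finsum_vec_closed) (use d in auto)
  have unique: "\<exists>!z. is_sol z" unfolding is_sol_def
    by (rule unique_solution_if_kernel_trivial[OF Ssum rhs schur_kernel_trivial])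
  have "(\<lambda>l. x i l $ r) \<longlonglongrightarrow> z $ r"
    if sol: "is_sol z" and active: "\<forall>i<p. infinite {k. i \<in> P k}"
      and delays: "\<forall>i<p. \<forall>j<p. (\<forall>k. \<tau> i j k \<le> k) \<and> filterlim (\<tau> i j) at_top sequentially"
      and it: "async_schur_iterates m p S d M J P \<tau> x" and i: "i < p" and r: "r < m"
    for z P \<tau> x i r
  proof -
    define y where "y = (\<lambda>j k. J j *\<^sub>v x j k + mat_inv M *\<^sub>v (d j - S j *\<^sub>v x j k))"
    have z: "z \<in> carrier_vec m" and Sz: "mat_sum m p S *\<^sub>v z = finsum_vec TYPE('a) m d {..<p}"
      using sol by (auto simp: is_sol_def)
    have x0: "x i 0 \<in> carrier_vec m" and
      x_Suc: "x i (Suc k) = (if i \<in> P k then finsum_vec TYPE('a) m (\<lambda>j. y j (\<tau> i j k)) {..<p} else x i k)"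
      if "i < p" for i k
      using it that unfolding async_schur_iterates_def Let_def y_def by auto
    note Minv = mat_inv_inverts(2)[OF M M_inv]
    have y_carrier: "y j k \<in> carrier_vec m" if "j < p" for j k
      unfolding y_def carrier_vec_def using Minv that by simp
    have x: "x i k \<in> carrier_vec m" if "i < p" for i k
      using that by (induction k) (auto simp: x0 x_Suc intro!: finsum_vec_closed y_carrier)
    \<comment> \<open>The contribution at the iterate, split into the effect of the error and the contribution at \<open>z\<close>;
      the latter contributions add up to \<open>z\<close> itself.\<close>
    have y_entry: "y j k $ s = local_error j (x j k - z) s + local_error j z s + d j $ s / M $$ (s, s)"
      if j: "j < p" and s: "s < m" for j k s
    proof -
      have "d j - S j *\<^sub>v x j k \<in> carrier_vec m" using S_carrier[OF j] x[OF j] d[OF j] by auto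
      note Md = diagonal_mat_inv_vec(2)[OF M M_inv M_diag this s]
      have diff: "(B *\<^sub>v (x j k - z)) $ s = (B *\<^sub>v x j k) $ s - (B *\<^sub>v z) $ s"
        if "B \<in> carrier_mat m m" for B
        using mult_minus_distrib_mat_vec[OF that x[OF j] z] that s by simp
      have "y j k $ s = (J j *\<^sub>v x j k) $ s + (mat_inv M *\<^sub>v (d j - S j *\<^sub>v x j k)) $ s"
        unfolding y_def using Minv J[OF j] s by simp
      thus ?thesis using S_carrier[OF j] d[OF j] s
        unfolding Md local_error_def diff[OF J[OF j]] diff[OF S_carrier[OF j]]
        by (simp add: diff_divide_distrib)
    qed
    have fixed: "(\<Sum>j<p. local_error j z s + d j $ s / M $$ (s, s)) = z $ s" if s: "s < m" for s
    proof -
      have "finsum_vec TYPE('a) m d {..<p} $ s = (\<Sum>j<p. d j $ s)"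
        by (rule index_finsum_vec) (use d s in auto)
      thus ?thesis
        by (simp add: sum.distrib sum_local_error[OF z s] Sz sum_divide_distrib)
    qed
    have error: "x i (Suc k) $ s - z $ s = (\<Sum>j<p. local_error j (x j (\<tau> i j k) - z) s)"
      if i: "i < p" and s: "s < m" and P: "i \<in> P k" for i k s
    proof -
      have "x i (Suc k) $ s = (\<Sum>j<p. y j (\<tau> i j k) $ s)"
        using x_Suc[OF i, of k] P y_carrier s by (simp add: index_finsum_vec)
      also have "\<dots> = (\<Sum>j<p. local_error j (x j (\<tau> i j k) - z) s +
          (local_error j z s + d j $ s / M $$ (s, s)))"
        by (rule sum.cong) (use y_entry s in \<open>auto simp: add.assoc\<close>)
      also have "\<dots> = (\<Sum>j<p. local_error j (x j (\<tau> i j k) - z) s) + z $ s"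
        unfolding sum.distrib[of _ _ "{..<p}"] fixed[OF s, unfolded sum.distrib] ..
      finally show ?thesis by simp
    qed
    obtain k v where k: "0 \<le> k" "k < 1" and v: "\<And>c. c < m \<Longrightarrow> v c > 0"
      and contr: "\<forall>e t r. t \<ge> 0 \<longrightarrow> r < m \<longrightarrow>
        (\<forall>j<p. e j \<in> carrier_vec m \<and> (\<forall>c<m. norm (e j $ c) \<le> t * v c)) \<longrightarrow>
        norm (\<Sum>j<p. local_error j (e j) r) \<le> k * t * v r"
      using contraction by blast
    have "(\<lambda>l. norm (x i l $ r - z $ r)) \<longlonglongrightarrow> 0"
    proof (rule asynchronous_contraction[where E = "\<lambda>i l s. norm (x i l $ s - z $ s)" and m = m and p = p
          and P = P and \<tau> = \<tau> and v = v and c = k])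
      fix i l s :: nat and t :: real
      assume i: "i < p" and s: "s < m" and P: "i \<in> P l" and t: "0 \<le> t"
        and le: "\<And>j s. j < p \<Longrightarrow> s < m \<Longrightarrow> norm (x j (\<tau> i j l) $ s - z $ s) \<le> t * v s"
      show "norm (x i (Suc l) $ s - z $ s) \<le> k * t * v s"
        unfolding error[OF i s P]
        by (rule contr[rule_format, OF t s]) (use x z le in auto)
    qed (use k v active delays x_Suc i r in auto)
    thus ?thesis by (simp add: LIM_zero_iff tendsto_norm_zero_iff)
  qed
  with unique show ?thesis
    unfolding async_schur_convergent_def Let_def is_sol_def d_def by blast
qed

end
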